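(* Let $p$ be a prime and $n\geq 1$ an integer, and let $R_{n,p}=\mathbb{F}_{p^n}[x]/(x^2)$. Then the automorphic multiaction $\Gamma^{\mathrm{aut}}(R_{n,p})$ is a monoidal network if and only if $n\leq 3$.
   Context: All rings are commutative with identity. For a ring $R$, $\mathrm{Aut}(R)$ is its group of ring automorphisms and $R^{\mathrm{Aut}(R)}$ the subring of elements fixed by every automorphism. A group action of $G$ on a set $X$ means a homomorphism $G\to\mathrm{Sym}(X)$; for $S\subseteq X$, $G^S$ denotes the setwise stabilizer of $S$. A multiaction on $R$ is a family $\{(\Gamma_I,\gamma_I)\}$ indexed by the ideals $I$ of $R$, where $(\Gamma_I,\gamma_I)$ is an action of a group $\Gamma_I$ on the set $R/I$ whose image contains the image of the natural action of $\mathrm{Aut}(R/I)$; $\Gamma_0$ (zero ideal, acting on $R$) is the top action group. The automorphic multiaction $\Gamma^{\mathrm{aut}}(R)$ has $\Gamma_I=\mathrm{Aut}(R/I)$ acting naturally. An extended submonoid of $R$ is a multiplicatively closed subset $M\subseteq R$ with $1\in M$ and $R^{\mathrm{Aut}(R)}\subseteq M$. Given a multiaction, an extended submonoid $M$ and an ideal $I$ with projection $\pi:R\to R/I$, $I$ is a covering ideal of $M$ if there is an extended submonoid $\hat M\subseteq M$ with $M\setminus\hat M\subseteq I$ such that for every $g\in\Gamma_I^{\pi(\hat M)}$ there is $\tilde g\in\Gamma_0^{\hat M}$ with $\pi(\tilde g\cdot x)=g\cdot\pi(x)$ for all $x\in\hat M$. A multiaction is a monoidal network if every extended submonoid of $R$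 has a covering ideal that is proper and nonzero. *)

theory Defs
  imports "HOL-Algebra.Algebra" "HOL-Computational_Algebra.Primes"
begin

text \<open>Automorphisms are taken extensional, as in \<^const>\<open>Bij\<close>, so that they form a subgroup of
  the symmetric group \<^const>\<open>BijGroup\<close> of the carrier.\<close>

definition ring_auto :: "('a, 'b) ring_scheme \<Rightarrow> ('a \<Rightarrow> 'a) set"
  where "ring_auto R = ring_hom R R \<inter> Bij (carrier R)"

definition RingAutoGroup :: "('a, 'b) ring_scheme \<Rightarrow> ('a \<Rightarrow> 'a) monoid"
  where "RingAutoGroup R = BijGroup (carrier R) \<lparr>carrier := ring_auto R\<rparr>"

definition aut_fixed_ring :: "('a, 'b) ring_scheme \<Rightarrow> 'a set"
  where "aut_fixed_ring R = {x \<in> carrier R. \<forall>f \<in> ring_auto R. f x = x}"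

definition setwise_stabilizer :: "('g, 'm) monoid_scheme \<Rightarrow> ('g \<Rightarrow> 'x \<Rightarrow> 'x) \<Rightarrow> 'x set \<Rightarrow> 'g set"
  where "setwise_stabilizer G \<phi> S = {g \<in> carrier G. \<phi> g ` S = S}"

text \<open>The families \<open>\<Gamma>\<close> (groups) and \<open>\<gamma>\<close> (actions) are indexed by subsets of the carrier; only their
  values at ideals matter.\<close>

definition multiaction ::
    "('a, 'b) ring_scheme \<Rightarrow> ('a set \<Rightarrow> ('g, 'm) monoid_scheme) \<Rightarrow>
     ('a set \<Rightarrow> 'g \<Rightarrow> 'a set \<Rightarrow> 'a set) \<Rightarrow> bool"
  where "multiaction R \<Gamma> \<gamma> \<longleftrightarrow>
    cring R \<and>
    (\<forall>I. ideal I R \<longrightarrow>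
       group_action (\<Gamma> I) (carrier (R Quot I)) (\<gamma> I) \<and>
       ring_auto (R Quot I) \<subseteq> \<gamma> I ` carrier (\<Gamma> I))"

text \<open>The elements of \<open>R Quot {\<zero>}\<close> are the singletons \<open>{\<zero>} +> x = {x}\<close>.  Identifying \<open>{x}\<close> with
  \<open>x\<close>, the group at the zero ideal acts on \<open>R\<close> itself.\<close>

definition top_action ::
    "('a, 'b) ring_scheme \<Rightarrow> ('a set \<Rightarrow> 'g \<Rightarrow> 'a set \<Rightarrow> 'a set) \<Rightarrow> 'g \<Rightarrow> 'a \<Rightarrow> 'a"
  where "top_action R \<gamma> g x = the_elem (\<gamma> {\<zero>\<^bsub>R\<^esub>} g ({\<zero>\<^bsub>R\<^esub>} +>\<^bsub>R\<^esub> x))"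

definition extended_submonoid :: "('a, 'b) ring_scheme \<Rightarrow> 'a set \<Rightarrow> bool"
  where "extended_submonoid R M \<longleftrightarrow> submonoid M R \<and> aut_fixed_ring R \<subseteq> M"

definition covering_ideal ::
    "('a, 'b) ring_scheme \<Rightarrow> ('a set \<Rightarrow> ('g, 'm) monoid_scheme) \<Rightarrow>
     ('a set \<Rightarrow> 'g \<Rightarrow> 'a set \<Rightarrow> 'a set) \<Rightarrow> 'a set \<Rightarrow> 'a set \<Rightarrow> bool"
  where "covering_ideal R \<Gamma> \<gamma> M I \<longleftrightarrow>
    ideal I R \<and>
    (\<exists>M'. extended_submonoid R M' \<and> M' \<subseteq> M \<and> M - M' \<subseteq> I \<and>
       (\<forall>g \<in> setwise_stabilizer (\<Gamma> I) (\<gamma> I) ((\<lambda>x. I +>\<^bsub>R\<^esub> x) ` M').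
          \<exists>h \<in> setwise_stabilizer (\<Gamma> {\<zero>\<^bsub>R\<^esub>}) (top_action R \<gamma>) M'.
            \<forall>x \<in> M'. I +>\<^bsub>R\<^esub> top_action R \<gamma> h x = \<gamma> I g (I +>\<^bsub>R\<^esub> x)))"

definition monoidal_network ::
    "('a, 'b) ring_scheme \<Rightarrow> ('a set \<Rightarrow> ('g, 'm) monoid_scheme) \<Rightarrow>
     ('a set \<Rightarrow> 'g \<Rightarrow> 'a set \<Rightarrow> 'a set) \<Rightarrow> bool"
  where "monoidal_network R \<Gamma> \<gamma> \<longleftrightarrow>
    multiaction R \<Gamma> \<gamma> \<and>
    (\<forall>M. extended_submonoid R M \<longrightarrow>
       (\<exists>I. covering_ideal R \<Gamma> \<gamma> M I \<and> I \<noteq> carrier R \<and> I \<noteq> {\<zero>\<^bsub>R\<^esub>}))"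

definition aut_groups :: "('a, 'b) ring_scheme \<Rightarrow> 'a set \<Rightarrow> ('a set \<Rightarrow> 'a set) monoid"
  where "aut_groups R I = RingAutoGroup (R Quot I)"

definition aut_actions :: "'a set \<Rightarrow> ('a set \<Rightarrow> 'a set) \<Rightarrow> 'a set \<Rightarrow> 'a set"
  where "aut_actions I f = f"

text \<open>\<open>Rupt K p\<close> is the quotient \<open>K[X]/(p)\<close>; \<open>p\<close> need not be irreducible.\<close>

definition dual_number_ring :: "('a, 'b) ring_scheme \<Rightarrow> 'a list set ring"
  where "dual_number_ring F = Rupt\<^bsub>F\<^esub> (carrier F) (X\<^bsub>F\<^esub> [^]\<^bsub>poly_ring F\<^esub> (2::nat))"

lemma subgroup_ring_auto:
  assumes "ring R"
  shows "subgroup (ring_auto R) (BijGroup (carrier R))"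
proof -
  interpret ring R by fact
  interpret G: group "BijGroup (carrier R)" by (rule group_BijGroup)
  have 1: "(\<lambda>x\<in>carrier R. x) \<in> ring_auto R"
    by (auto simp: ring_auto_def id_Bij ring_hom_def)
  have cl: "compose (carrier R) f g \<in> ring_auto R"
    if "f \<in> ring_auto R" "g \<in> ring_auto R" for f g
  proof -
    have "compose (carrier R) f g \<in> ring_hom R R"
      using that by (auto simp: ring_auto_def ring_hom_def compose_def Pi_iff)
    then show ?thesis using that by (simp add: ring_auto_def compose_Bij)
  qed
  have iv: "(\<lambda>x\<in>carrier R. inv_into (carrier R) f x) \<in> ring_auto R" if f: "f \<in> ring_auto R" for f
  proof -
    have fB: "f \<in> Bij (carrier R)" and fh: "f \<in> ring_hom R R" using f by (auto simp: ring_auto_def)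
    have bij: "bij_betw f (carrier R) (carrier R)" using fB by (simp add: Bij_def)
    have "f \<in> ring_iso R R" using bij fh by (simp add: ring_iso_def)
    then have "inv_into (carrier R) f \<in> ring_hom R R"
      using ring_iso_set_sym[OF ring_axioms] by (auto simp: ring_iso_def)
    then show ?thesis
      using restrict_inv_into_Bij[OF fB] by (auto simp: ring_auto_def ring_hom_def Pi_iff)
  qed
  show ?thesis
  proof (rule G.subgroupI)
    show "ring_auto R \<subseteq> carrier (BijGroup (carrier R))"
      by (auto simp: ring_auto_def BijGroup_def)
    show "ring_auto R \<noteq> {}" using 1 by blast
    show "inv\<^bsub>BijGroup (carrier R)\<^esub> f \<in> ring_auto R" if "f \<in> ring_auto R" for f
      using iv[OF that] that by (simp add: inv_BijGroup ring_auto_def)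
    show "f \<otimes>\<^bsub>BijGroup (carrier R)\<^esub> g \<in> ring_auto R"
      if "f \<in> ring_auto R" "g \<in> ring_auto R" for f g
      using cl[OF that] that by (simp add: BijGroup_def ring_auto_def)
  qed
qed

lemma multiaction_aut:
  assumes "cring R"
  shows "multiaction R (aut_groups R) aut_actions"
  unfolding multiaction_def
proof (intro conjI allI impI)
  fix I assume I: "ideal I R"
  let ?B = "BijGroup (carrier (R Quot I))"
  have sg: "subgroup (ring_auto (R Quot I)) ?B"
    by (rule subgroup_ring_auto[OF ideal.quotient_is_ring[OF I]])
  interpret G: group ?B by (rule group_BijGroup)
  have "group_hom (aut_groups R I) ?B (aut_actions I)"
    using subgroup.subgroup_is_group[OF sg G.is_group] subgroup.subset[OF sg]
    by (auto simp: group_hom_def group_hom_axioms_def hom_def aut_groups_def RingAutoGroup_def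
        aut_actions_def group_BijGroup)
  then show "group_action (aut_groups R I) (carrier (R Quot I)) (aut_actions I)"
    by (simp add: group_action_def)
  show "ring_auto (R Quot I) \<subseteq> aut_actions I ` carrier (aut_groups R I)"
    by (auto simp: aut_groups_def RingAutoGroup_def aut_actions_def image_def)
qed (use assms in auto)

end

theory Submission
  imports Defs
begin

text \<open>
  Write \<open>a + b\<epsilon>\<close> for the elements of \<open>R = F[x]/(x\<^sup>2)\<close>. The only proper nonzero ideal is \<open>(\<epsilon>)\<close>, with
  quotient \<open>F\<close>, and every pair of \<open>\<sigma> \<in> Aut(F)\<close> and \<open>c \<noteq> 0\<close> gives an automorphism
  \<open>a + b\<epsilon> \<mapsto> \<sigma>(a) + c \<sigma>(b) \<epsilon>\<close> of \<open>R\<close>. The units of an extended submonoid form a subgroup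
  \<open>C \<times> (1 + V\<epsilon>)\<close> with \<open>C\<close> a subgroup of the cyclic group of units of \<open>F\<close>, hence stable under each
  \<open>\<sigma>\<close>, and \<open>V\<close> an additive subgroup of \<open>F\<close>. So the network property says that for all \<open>\<sigma>\<close> and \<open>V\<close>
  there is \<open>c \<noteq> 0\<close> with \<open>c \<sigma>(V) = V\<close>. For \<open>n \<le> 3\<close> any two additive subgroups of equal order differ by
  a scalar. For \<open>n \<ge> 4\<close> take for \<open>\<sigma>\<close> the Frobenius automorphism and for \<open>V\<close> the span of \<open>1\<close> and \<open>t\<close>
  over the prime field; then \<open>c \<sigma>(V) = V\<close> forces \<open>t\<^sup>p\<close> to be the image of \<open>t\<close> under a Moebius
  transformation over the prime field. A count of roots shows that for \<open>n \<ge> 5\<close> not every \<open>t\<close> is of this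
  kind; for \<open>n = 4\<close> a suitable power of a generator of the unit group is not.
\<close>

section \<open>Finite fields\<close>

text \<open>Induction on \<open>n\<close>: multiply the expansion by \<open>a\<close> and by
  \<open>b\<close>, align the exponents and add with Pascal's rule. The integer coefficients act
  through \<open>add_pow\<close>.\<close>

lemma (in cring) binomial:
  fixes n :: nat
  assumes a: "a \<in> carrier R" and b: "b \<in> carrier R"
  shows "(a \<oplus> b) [^] n = (\<Oplus>k\<in>{..n}. add_pow R (n choose k) (a [^] k \<otimes> b [^] (n - k)))"
proof (induction n)
  case 0
  show ?case using a b by simp
next
  case (Suc n)
  let ?m = "\<lambda>k. a [^] Suc k \<otimes> b [^] (n - k)"
  have "(\<Oplus>k\<in>{..n}. add_pow R (n choose k) (a [^] k \<otimes> b [^] (n - k))) \<otimes> a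
    = (\<Oplus>k\<in>{..n}. add_pow R (n choose k) (a [^] k \<otimes> b [^] (n - k)) \<otimes> a)"
    using a b by (intro finsum_ldistr) auto
  also have "\<dots> = (\<Oplus>k\<in>{..n}. add_pow R (n choose k) (?m k))"
    using a b by (intro finsum_cong') (auto simp: add_pow_ldistr add_pow_rdistr m_ac)
  finally have 1: "(\<Oplus>k\<in>{..n}. add_pow R (n choose k) (a [^] k \<otimes> b [^] (n - k))) \<otimes> a
    = (\<Oplus>k\<in>{..n}. add_pow R (n choose k) (?m k))" .
  have "(\<Oplus>k\<in>{..n}. add_pow R (n choose k) (a [^] k \<otimes> b [^] (n - k))) \<otimes> b
    = (\<Oplus>k\<in>{..n}. add_pow R (n choose k) (a [^] k \<otimes> b [^] (n - k)) \<otimes> b)"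
    using a b by (intro finsum_ldistr) auto
  also have "\<dots> = (\<Oplus>k\<in>{..n}. add_pow R (n choose k) (a [^] k \<otimes> b [^] (Suc n - k)))"
    using a b by (intro finsum_cong') (auto simp: add_pow_ldistr m_assoc Suc_diff_le)
  \<comment> \<open>Appending the term \<open>k = Suc n\<close> costs nothing, since
    \<open>n choose Suc n = 0\<close>. Splitting off \<open>k = 0\<close> then leaves the exponents
    \<open>Suc k\<close> of the other sum.\<close>
  also have "\<dots> = (\<Oplus>k\<in>{..Suc n}. add_pow R (n choose k) (a [^] k \<otimes> b [^] (Suc n - k)))"
    using a b by (subst finsum_Suc) (auto simp: binomial_eq_0)
  also have "\<dots> = (\<Oplus>k\<in>{..n}. add_pow R (n choose Suc k) (?m k)) \<oplus> b [^] Suc n"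
    using a b by (subst finsum_Suc2) auto
  finally have 2: "(\<Oplus>k\<in>{..n}. add_pow R (n choose k) (a [^] k \<otimes> b [^] (n - k))) \<otimes> b
    = (\<Oplus>k\<in>{..n}. add_pow R (n choose Suc k) (?m k)) \<oplus> b [^] Suc n" .
  have "(a \<oplus> b) [^] Suc n = (\<Oplus>k\<in>{..n}. add_pow R (n choose k) (?m k))
      \<oplus> ((\<Oplus>k\<in>{..n}. add_pow R (n choose Suc k) (?m k)) \<oplus> b [^] Suc n)"
    using a b Suc by (simp add: r_distr 1 2)
  also have "\<dots> = (\<Oplus>k\<in>{..n}. add_pow R (n choose k) (?m k) \<oplus> add_pow R (n choose Suc k) (?m k)) \<oplus> b [^] Suc n"
    using a b by (subst finsum_addf) (auto simp: a_assoc)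
  also have "\<dots> = (\<Oplus>k\<in>{..n}. add_pow R (Suc n choose Suc k) (?m k)) \<oplus> b [^] Suc n"
    using a b by (auto simp: add.nat_pow_mult intro!: arg_cong2[where f = "(\<oplus>)"] finsum_cong')
  also have "\<dots> = (\<Oplus>k\<in>{..Suc n}. add_pow R (Suc n choose k) (a [^] k \<otimes> b [^] (Suc n - k)))"
    using a b by (subst finsum_Suc2) auto
  finally show ?case .
qed

text \<open>For \<open>0 < k < p\<close> the prime \<open>p\<close> divides
  \<open>p choose k\<close>, so in characteristic \<open>p\<close> only the two end terms of the
  binomial expansion survive.\<close>

lemma (in cring) prime_char_power_add:
  assumes p: "Factorial_Ring.prime (p :: nat)" and char: "add_pow R p \<one> = \<zero>"
    and a: "a \<in> carrier R" and b: "b \<in> carrier R"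
  shows "(a \<oplus> b) [^] p = a [^] p \<oplus> b [^] p"
proof -
  have ch0: "add_pow R p x = \<zero>" if "x \<in> carrier R" for x
    using add_pow_ldistr[of \<one> x p] that char by simp
  have mid: "add_pow R (p choose k) (a [^] k \<otimes> b [^] (p - k)) = \<zero>" if "0 < k" "k < p" for k
  proof -
    have "p dvd p choose k" using that p by (intro dvd_choose_prime) auto
    then obtain j where "p choose k = p * j" by (auto elim: dvdE)
    then show ?thesis using a b by (simp add: ch0 flip: add.nat_pow_pow)
  qed
  \<comment> \<open>With \<open>p = r + 2\<close>, cutting both ends off \<open>{..p}\<close> leaves
    \<open>r + 1\<close> middle terms, indexed from \<open>0\<close> to \<open>r\<close>.\<close>
  obtain r where r: "p = Suc (Suc r)" using prime_ge_2_nat[OF p] by (metis add_2_eq_Suc le_Suc_ex)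
  have "add_pow R (p choose Suc k) (a [^] Suc k \<otimes> b [^] (p - Suc k)) = \<zero>" if "k \<le> r" for k
    using mid[of "Suc k"] that r by simp
  then have "(\<Oplus>k\<in>{..r}. add_pow R (p choose Suc k) (a [^] Suc k \<otimes> b [^] (p - Suc k))) = (\<Oplus>k\<in>{..r}. \<zero>)"
    by (intro finsum_cong') auto
  then have "(\<Oplus>k\<in>{..p}. add_pow R (p choose k) (a [^] k \<otimes> b [^] (p - k))) = b [^] p \<oplus> a [^] p"
    unfolding r using a b
    by (subst finsum_Suc, force, subst finsum_Suc2) (auto simp: a_comm simp del: binomial_Suc_Suc nat_pow_Suc)
  then show ?thesis using binomial[OF a b, of p] a b by (simp add: a_comm)
qed

lemma (in domain) nat_pow_eq_zeroD:
  assumes "a \<in> carrier R" "a [^] (k :: nat) = \<zero>"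
  shows "a = \<zero>"
  using assms(2) by (induction k) (use assms(1) in \<open>auto simp: integral_iff\<close>)

section \<open>Fields of order p^n: characteristic and Frobenius map\<close>

locale prime_power_field = field F for F (structure) +
  fixes p n :: nat
  assumes prime_p: "Factorial_Ring.prime p" and order_F: "order F = p ^ n"
begin

lemma finite_carrier: "finite (carrier F)"
  using order_F prime_gt_0_nat[OF prime_p] by (metis card.infinite neq0_conv order_def power_not_zero)

lemma n_pos: "n > 0"
proof (rule ccontr)
  assume "\<not> n > 0"
  then have "card (carrier F) = 1" using order_F by (simp add: order_def)
  then obtain x where "carrier F = {x}" by (auto simp: card_1_singleton_iff)
  then show False using zero_closed one_closed zero_not_one by simp
qed

lemma order_gt_1: "order F > 1"
  using order_F n_pos one_less_power[OF prime_gt_1_nat[OF prime_p], of n] by simp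

lemma add_pow_order: "x \<in> carrier F \<Longrightarrow> add_pow F (order F) x = \<zero>"
  using add.pow_order_eq_1[of x] by (simp add: order_def)

lemma add_pow_one_mult:
  fixes j :: nat
  shows "add_pow F (j * k) \<one> = add_pow F j \<one> \<otimes> add_pow F k \<one>"
  by (simp add: add_pow_ldistr add.nat_pow_pow mult.commute)

text \<open>\<open>add_pow F (p ^ k) \<one>\<close> is the \<open>k\<close>-th power of
  \<open>add_pow F p \<one>\<close> and vanishes for \<open>k = n\<close>; a field has no nonzero
  nilpotents.\<close>

lemma char_p: "add_pow F p \<one> = \<zero>"
proof -
  have "add_pow F (p ^ k) \<one> = \<zero> \<Longrightarrow> k > 0 \<Longrightarrow> add_pow F p \<one> = \<zero>" for k
  proof (induction k)
    case (Suc k)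
    then have "add_pow F p \<one> \<otimes> add_pow F (p ^ k) \<one> = \<zero>"
      by (simp add: add_pow_one_mult)
    then have "add_pow F p \<one> = \<zero> \<or> add_pow F (p ^ k) \<one> = \<zero>"
      by (simp add: integral_iff)
    then show ?case using Suc by (cases k) auto
  qed simp
  then show ?thesis using add_pow_order[of \<one>] order_F n_pos by auto
qed

lemma add_pow_p: "x \<in> carrier F \<Longrightarrow> add_pow F p x = \<zero>"
  using add_pow_ldistr[of \<one> x p] char_p by simp

lemma power_p_add:
  "a \<in> carrier F \<Longrightarrow> b \<in> carrier F \<Longrightarrow> (a \<oplus> b) [^] p = a [^] p \<oplus> b [^] p"
  by (rule prime_char_power_add[OF prime_p char_p])

text \<open>The \<open>p\<close>-th power map is additive, and only zero has \<open>p\<close>-th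
  power zero.\<close>

lemma power_p_inj:
  assumes "a \<in> carrier F" "b \<in> carrier F" "a [^] p = b [^] p"
  shows "a = b"
proof -
  have "(a \<ominus> b) [^] p \<oplus> b [^] p = (a \<ominus> b \<oplus> b) [^] p" using assms by (simp add: power_p_add)
  also have "a \<ominus> b \<oplus> b = a" using assms by (simp add: a_minus_def a_assoc l_neg)
  finally have "(a \<ominus> b) [^] p \<oplus> b [^] p = \<zero> \<oplus> b [^] p" using assms by simp
  then have "(a \<ominus> b) [^] p = \<zero>" using assms by (subst (asm) add.right_cancel) auto
  then have "a \<ominus> b = \<zero>" using assms nat_pow_eq_zeroD by blast
  then show ?thesis using assms by simp
qed

lemma frobenius_iso: "(\<lambda>x. x [^] p) \<in> ring_iso F F"
proof (rule ring_iso_memI)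
  have inj: "inj_on (\<lambda>x. x [^] p) (carrier F)"
    by (rule inj_onI) (rule power_p_inj)
  have "(\<lambda>x. x [^] p) ` carrier F \<subseteq> carrier F" by (rule image_subsetI) (rule nat_pow_closed)
  then have "(\<lambda>x. x [^] p) ` carrier F = carrier F" using inj by (rule endo_inj_surj[OF finite_carrier])
  with inj show "bij_betw (\<lambda>x. x [^] p) (carrier F) (carrier F)"
    unfolding bij_betw_def by (rule conjI)
qed (simp_all add: power_p_add nat_pow_distrib)

section \<open>The cyclic group of units\<close>

abbreviation (input) mult_F where "mult_F \<equiv> Multiplicative_Group.mult_of F"

lemma finite_mult: "finite (carrier mult_F)"
  using finite_carrier by (rule finite_mult_of)

lemma group_mult:
  "group mult_F" "([^]\<^bsub>mult_F\<^esub>) = (([^]) :: _ \<Rightarrow> nat \<Rightarrow> _)"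
  by (rule field_mult_group) (simp add: fun_eq_iff nat_pow_def)

lemma power_order_minus_1:
  assumes "a \<in> carrier F" "a \<noteq> \<zero>"
  shows "a [^] (order F - 1) = \<one>"
  using group.pow_order_eq_1[OF group_mult(1), of a] assms finite_carrier
  by (simp add: order_mult_of group_mult(2))

lemma power_order:
  assumes "a \<in> carrier F"
  shows "a [^] order F = a"
proof (cases "a = \<zero>")
  case True
  then show ?thesis using order_gt_1 by (simp add: nat_pow_zero)
next
  case False
  have "a [^] (Suc (order F - 1)) = a" using assms False power_order_minus_1[of a] by simp
  then show ?thesis using order_gt_1 by simp
qed

text \<open>Cyclicity is a library fact. The order of \<open>g\<close> comes from a count: the
  powers of \<open>g\<close> with exponent below its order already exhaust the
  \<open>order F - 1\<close> units.\<close>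

lemma obtains_generator:
  obtains g where "g \<in> carrier F" "g \<noteq> \<zero>" "group.ord mult_F g = order F - 1"
    "\<And>x. x \<in> carrier F \<Longrightarrow> x \<noteq> \<zero> \<Longrightarrow> \<exists>k::nat. x = g [^] k"
proof -
  obtain g where g: "g \<in> carrier mult_F" and gen: "carrier mult_F = {g [^] i | i::nat. i \<in> UNIV}"
    using finite_field_mult_group_has_gen[OF finite_carrier] by auto
  have "carrier mult_F = {g [^] i | i. i \<in> {0 .. group.ord mult_F g - 1}}"
    using group.ord_elems[OF group_mult(1) finite_mult g] gen by (simp add: group_mult(2))
  then have "carrier mult_F = (\<lambda>i. g [^] i) ` {0 .. group.ord mult_F g - 1}" by blast
  then have "card (carrier mult_F) \<le> card {0 .. group.ord mult_F g - 1}"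
    by (metis card_image_le finite_atLeastAtMost)
  moreover have "group.ord mult_F g \<ge> 1" by (rule group.ord_ge_1[OF group_mult(1) finite_mult g])
  moreover have "group.ord mult_F g \<le> card (carrier mult_F)"
    using group.ord_le_group_order[OF group_mult(1) finite_mult g] by (simp add: order_def)
  ultimately have "group.ord mult_F g = order F - 1"
    using order_mult_of[OF finite_carrier] by (simp add: order_def)
  then show ?thesis using that[of g] g gen by (auto simp: carrier_mult_of)
qed

text \<open>An automorphism is determined on the units by the image \<open>g [^] m\<close> of a
  generator \<open>g\<close>. Hence every submonoid of the units is stable under every field
  automorphism.\<close>

lemma ring_iso_power:
  assumes f: "f \<in> ring_iso F F"
  obtains m :: nat where "\<And>a. a \<in> carrier F \<Longrightarrow> a \<noteq> \<zero> \<Longrightarrow> f a = a [^] m"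
proof -
  obtain g where g: "g \<in> carrier F" "g \<noteq> \<zero>" and gen: "\<And>x. x \<in> carrier F \<Longrightarrow> x \<noteq> \<zero> \<Longrightarrow> \<exists>k::nat. x = g [^] k"
    using obtains_generator by metis
  interpret f: ring_hom_ring F F f
    using f ring_axioms by (auto simp: ring_iso_def intro!: ring_hom_ringI2)
  have "f g \<noteq> f \<zero>"
    using inj_onD[OF bij_betw_imp_inj_on[OF ring_iso_memE(5)[OF f]], of g \<zero>] g by auto
  then obtain m :: nat where m: "f g = g [^] m" using gen[of "f g"] g by auto
  show ?thesis
  proof (rule that)
    fix a assume "a \<in> carrier F" "a \<noteq> \<zero>"
    then obtain k :: nat where "a = g [^] k" using gen by blast
    then show "f a = a [^] m"
      using g m by (simp add: f.hom_nat_pow nat_pow_pow mult.commute)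
  qed
qed

end

section \<open>Rescaling additive subgroups\<close>

text \<open>Pigeonhole: addition on \<open>A \<times> B\<close> cannot be injective, and a collision
  \<open>x + y = x' + y'\<close> puts \<open>x - x' = y' - y\<close> into both subgroups.\<close>

lemma (in ring) additive_subgroup_common_nonzero:
  assumes A: "additive_subgroup A R" and B: "additive_subgroup B R"
    and fin: "finite (carrier R)" and less: "card (carrier R) < card A * card B"
  obtains x where "x \<in> A" "x \<in> B" "x \<noteq> \<zero>"
proof -
  interpret A: additive_subgroup A R by (rule A)
  interpret B: additive_subgroup B R by (rule B)
  have "(\<lambda>(x, y). x \<oplus> y) ` (A \<times> B) \<subseteq> carrier R" using A.a_subset B.a_subset by auto
  then have "\<not> inj_on (\<lambda>(x, y). x \<oplus> y) (A \<times> B)"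
    using less card_inj_on_le[OF _ _ fin, of "\<lambda>(x, y). x \<oplus> y" "A \<times> B"]
    by (metis card_cartesian_product not_le)
  then obtain x y x' y' where xy: "x \<in> A" "x' \<in> A" "y \<in> B" "y' \<in> B"
    and eq: "x \<oplus> y = x' \<oplus> y'" and ne: "(x, y) \<noteq> (x', y')"
    by (clarsimp simp: inj_on_def)
  have c: "x \<in> carrier R" "x' \<in> carrier R" "y \<in> carrier R" "y' \<in> carrier R"
    using xy A.a_subset B.a_subset by auto
  have "x \<ominus> x' = (x \<oplus> y) \<ominus> y \<ominus> x'" using c by algebra
  also have "\<dots> = y' \<ominus> y" unfolding eq using c by algebra
  finally have d: "x \<ominus> x' = y' \<ominus> y" .
  show ?thesis
  proof (rule that)
    show "x \<ominus> x' \<in> A" using xy by (simp add: a_minus_def)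
    show "x \<ominus> x' \<in> B" unfolding d using xy by (simp add: a_minus_def)
    show "x \<ominus> x' \<noteq> \<zero>"
    proof
      assume "x \<ominus> x' = \<zero>"
      then have "x = x'" "y' = y" using d c r_right_minus_eq by metis+
      then show False using ne by simp
    qed
  qed
qed

context prime_power_field
begin

lemma card_additive_subgroup:
  assumes "additive_subgroup V F"
  obtains i where "i \<le> n" "card V = p ^ i"
proof -
  have "card (rcosets\<^bsub>add_monoid F\<^esub> V) * card V = order F"
    using add.lagrange[OF additive_subgroup.a_subgroup[OF assms]] by (simp add: order_def)
  then have "card V dvd p ^ n" using order_F by (metis dvd_triv_right)
  then show ?thesis using that by (auto simp: divides_primepow_nat[OF prime_p])
qed

lemma additive_subgroup_finite: "additive_subgroup V F \<Longrightarrow> finite V"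
  by (rule finite_subset[OF additive_subgroup.a_subset finite_carrier])

text \<open>Orders of additive subgroups are powers of \<open>p\<close>, and none lies strictly
  between \<open>p ^ i\<close> and \<open>p ^ Suc i\<close>.\<close>

lemma additive_subgroup_eqI:
  assumes U: "additive_subgroup U F" and V: "additive_subgroup V F" and "U \<subseteq> V"
    and card: "card V = p ^ Suc i" "card U > p ^ i"
  shows "U = V"
proof -
  obtain j where j: "card U = p ^ j" using card_additive_subgroup[OF U] .
  have "j > i" using card j prime_gt_1_nat[OF prime_p] by (simp add: power_strict_increasing_iff)
  then have "card U \<ge> card V" unfolding j card
    using prime_gt_1_nat[OF prime_p] by (intro power_increasing) auto
  then show ?thesis by (rule card_seteq[OF additive_subgroup_finite[OF V] \<open>U \<subseteq> V\<close>])
qed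

lemma additive_subgroup_scaled:
  assumes V: "additive_subgroup V F" and W: "additive_subgroup W F" and c: "c \<in> carrier F"
  shows "additive_subgroup {x \<in> V. c \<otimes> x \<in> W} F"
proof -
  interpret V: additive_subgroup V F by (rule V)
  interpret W: additive_subgroup W F by (rule W)
  show ?thesis
    using c by (intro additive_subgroupI subgroup.intro)
      (auto simp: r_distr r_minus V.a_subset[THEN subsetD] V.a_inv_closed W.a_inv_closed simp flip: a_inv_def)
qed

lemma card_scaled:
  assumes W: "W \<subseteq> carrier F" and v: "v \<in> carrier F" "v \<noteq> \<zero>"
  shows "card {x \<in> carrier F. x \<otimes> v \<in> W} = card W"
proof (rule bij_betw_same_card[of "\<lambda>x. x \<otimes> v"])
  show "bij_betw (\<lambda>x. x \<otimes> v) {x \<in> carrier F. x \<otimes> v \<in> W} W"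
    using v W field_Units
    by (intro bij_betw_byWitness[where f' = "\<lambda>x. x \<otimes> inv v"]) (auto simp: m_assoc)
qed

text \<open>The bound on \<open>n\<close> leaves only subgroups of order \<open>1\<close>, \<open>p\<close>, \<open>p\<^sup>n\<^sup>-\<^sup>1\<close> and \<open>p\<^sup>n\<close>.
  In order \<open>p\<^sup>2\<close> with \<open>n = 3\<close>, the scalars \<open>c\<close> that move a given element of \<open>V\<close> into \<open>W\<close> form a
  subgroup of order \<open>p\<^sup>2\<close>, and two such subgroups meet nontrivially.\<close>

lemma additive_subgroup_scaling:
  assumes V: "additive_subgroup V F" and W: "additive_subgroup W F"
    and card: "card V = card W" and n: "n \<le> 3"
  obtains c where "c \<in> carrier F" "c \<noteq> \<zero>" "\<And>v. v \<in> V \<Longrightarrow> c \<otimes> v \<in> W"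
proof -
  interpret V: additive_subgroup V F by (rule V)
  interpret W: additive_subgroup W F by (rule W)
  note Vc = V.a_subset[THEN subsetD] and Wc = W.a_subset[THEN subsetD]
  obtain i where i: "i \<le> n" "card V = p ^ i" using card_additive_subgroup[OF V] .
  have p1: "p > 1" by (rule prime_gt_1_nat[OF prime_p])
  have nz: "\<exists>v \<in> Y. v \<noteq> \<zero>" if "card Y > 1" for Y :: "'a set"
  proof (rule ccontr)
    assume "\<not> (\<exists>v \<in> Y. v \<noteq> \<zero>)"
    then have "card Y \<le> card {\<zero>}" by (intro card_mono) auto
    then show False using that by simp
  qed
  consider "i = 0" | "i = n" | "i = 1" | "i = 2" "n = 3" using i n by linarith
  then show ?thesis
  proof cases
    case 1
    then have "card V = 1" using i by simp
    then have "V = {\<zero>}" using V.zero_closed by (metis card_1_singletonE singletonD)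
    then show ?thesis using that[of \<one>] W.zero_closed by simp
  next
    case 2
    then have "W = carrier F"
      using i card order_F W.a_subset finite_carrier by (intro card_subset_eq) (auto simp: order_def)
    then show ?thesis using that[of \<one>] Vc by simp
  next
    case 3
    then obtain v w where vw: "v \<in> V" "v \<noteq> \<zero>" "w \<in> W" "w \<noteq> \<zero>"
      using nz[of V] nz[of W] card i p1 by auto
    \<comment> \<open>It suffices to move one nonzero element into \<open>W\<close>: the elements of
      \<open>V\<close> that \<open>c\<close> sends into \<open>W\<close> form a subgroup with more
      than one element, hence all of \<open>V\<close>, which has prime order.\<close>
    define c where "c = w \<otimes> inv v"
    have v': "inv v \<in> carrier F" "inv v \<otimes> v = \<one>" using vw Vc field_Units by auto
    have c: "c \<in> carrier F" "c \<otimes> v = w" using v' vw Vc Wc by (auto simp: c_def m_assoc)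
    have "{x \<in> V. c \<otimes> x \<in> W} = V"
    proof (rule additive_subgroup_eqI[OF additive_subgroup_scaled[OF V W c(1)] V, of 0])
      have "{\<zero>, v} \<subseteq> {x \<in> V. c \<otimes> x \<in> W}" using vw c V.zero_closed W.zero_closed by auto
      then have "card {\<zero>, v} \<le> card {x \<in> V. c \<otimes> x \<in> W}"
        using additive_subgroup_finite[OF V] by (intro card_mono) auto
      then show "p ^ 0 < card {x \<in> V. c \<otimes> x \<in> W}" using vw by simp
    qed (use i 3 in auto)
    moreover have "c \<noteq> \<zero>" using c vw Vc by auto
    ultimately show ?thesis using that[of c] c by blast
  next
    case 4
    obtain u where u: "u \<in> V" "u \<noteq> \<zero>"
      using nz[of V] i 4 p1 one_less_power[OF p1, of 2] by auto
    \<comment> \<open>\<open>G\<close> is the subgroup of order \<open>p\<close> generated by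
      \<open>u\<close>. As \<open>V\<close> has order \<open>p ^ 2\<close>, it contains some
      \<open>v\<close> outside \<open>G\<close>.\<close>
    define G where "G = generate (add_monoid F) {u}"
    have uc: "u \<in> carrier F" using u Vc by auto
    have "card G = add.ord u" using add.generate_pow_card[of u] uc by (simp add: G_def)
    moreover have "add.ord u dvd p" using add.pow_eq_id[of u p] uc add_pow_p by simp
    moreover have "add.ord u \<noteq> 1" using add.ord_eq_1[of u] uc u by simp
    ultimately have cG: "card G = p" using prime_p by (metis prime_nat_iff)
    have "\<not> V \<subseteq> G"
    proof
      assume "V \<subseteq> G"
      then have "card V \<le> card G" using cG p1 by (intro card_mono card_ge_0_finite) auto
      then show False using cG i 4 p1 by (simp add: power2_eq_square)
    qed
    then obtain v where v: "v \<in> V" "v \<notin> G" by auto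
    have "\<zero> \<in> G" unfolding G_def using generate.one[of "add_monoid F"] by simp
    then have v0: "v \<noteq> \<zero>" using v by auto
    define S where "S = (\<lambda>v. {x \<in> carrier F. v \<otimes> x \<in> W})"
    have S: "additive_subgroup (S x) F" "card (S x) = p ^ 2" if "x \<in> V" "x \<noteq> \<zero>" for x
    proof -
      have "additive_subgroup (carrier F) F" by (intro additive_subgroupI add.subgroup_self)
      then show "additive_subgroup (S x) F"
        unfolding S_def using W that Vc by (intro additive_subgroup_scaled) auto
      have "S x = {y \<in> carrier F. y \<otimes> x \<in> W}" using that Vc by (auto simp: S_def m_comm)
      then show "card (S x) = p ^ 2" using card_scaled[of W x] that Vc W.a_subset i card 4 by auto
    qed
    \<comment> \<open>Both sets of scalars have \<open>p ^ 2\<close> elements, and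
      \<open>p ^ 4 > p ^ 3\<close>.\<close>
    have "card (carrier F) < card (S u) * card (S v)"
      using S u v v0 order_F 4 p1 by (simp add: order_def power2_eq_square power3_eq_cube)
    then obtain c where c: "c \<in> S u" "c \<in> S v" "c \<noteq> \<zero>"
      using additive_subgroup_common_nonzero[OF S(1)[OF u] S(1)[OF v(1) v0] finite_carrier] by blast
    have cc: "c \<in> carrier F" "c \<otimes> u \<in> W" "c \<otimes> v \<in> W"
      using c u v Vc by (auto simp: S_def m_comm)
    let ?U = "{x \<in> V. c \<otimes> x \<in> W}"
    have U: "additive_subgroup ?U F" by (rule additive_subgroup_scaled[OF V W cc(1)])
    have "?U = V"
    proof (rule additive_subgroup_eqI[OF U V, of 1])
      \<comment> \<open>\<open>?U\<close> contains \<open>G\<close> and \<open>v\<close>, so at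
        least \<open>p + 1\<close> elements, which leaves only the order
        \<open>p ^ 2\<close>.\<close>
      have "G \<subseteq> ?U" unfolding G_def using u cc
        by (intro add.generate_subgroup_incl additive_subgroup.a_subgroup[OF U]) auto
      then have "insert v G \<subseteq> ?U" using v cc by auto
      then have "card (insert v G) \<le> card ?U"
        using additive_subgroup_finite[OF U] by (intro card_mono) auto
      then show "p ^ 1 < card ?U" using v cG p1 by (simp add: card_ge_0_finite)
    qed (use i 4 in \<open>auto simp: power2_eq_square\<close>)
    then show ?thesis using that[of c] cc c by blast
  qed
qed

end

section \<open>Elements with no Moebius relation to their Frobenius conjugate\<close>

text \<open>The polynomial is split as \<open>X^m + f\<close> with \<open>deg f < m\<close>, so its
  leading coefficient is \<open>1\<close>; it is nonzero of degree at most \<open>m\<close>, and the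
  root bound over a domain applies.\<close>

lemma (in domain) card_monic_roots:
  assumes fin: "finite (carrier R)" and f: "f \<in> carrier (UP R)" "deg R f < m"
  shows "card {x \<in> carrier R. x [^] m \<oplus> UnivPoly.eval R R id x f = \<zero>} \<le> m"
proof -
  interpret U: UP_domain R "UP R" by unfold_locales
  let ?f = "up_ring.monom (UP R) \<one> m \<oplus>\<^bsub>UP R\<^esub> f"
  have c: "?f \<in> carrier (UP R)" using f by simp
  have "up_ring.coeff (UP R) ?f m \<noteq> \<zero>" using f U.deg_aboveD[OF f(2,1)] by simp
  moreover have "deg R ?f \<le> m" using f by (intro U.deg_aboveI) (auto simp: U.deg_aboveD)
  moreover have "?f \<noteq> \<zero>\<^bsub>UP R\<^esub>" using calculation(1) by fastforce
  ultimately have "card {x \<in> carrier R. UnivPoly.eval R R id x ?f = \<zero>} \<le> m"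
    using U.roots_bound[OF c _ fin] by linarith
  moreover have "{x \<in> carrier R. x [^] m \<oplus> UnivPoly.eval R R id x f = \<zero>} = {x \<in> carrier R. UnivPoly.eval R R id x ?f = \<zero>}"
    using f by (auto simp: U.evalRR_simps)
  ultimately show ?thesis by simp
qed

section \<open>The prime field as fixed points of Frobenius\<close>

context prime_power_field
begin

text \<open>This is the prime field. As a fixed-point set it is closed under the field operations
  because Frobenius respects them, and its size is bounded by a count of roots.\<close>

definition frobenius_fixed :: "'a set"
  where "frobenius_fixed = {a \<in> carrier F. a [^] p = a}"

lemma frobenius_fixed_carrier: "a \<in> frobenius_fixed \<Longrightarrow> a \<in> carrier F"
  by (simp add: frobenius_fixed_def)

lemma power_p_minus: "a \<in> carrier F \<Longrightarrow> (\<ominus> a) [^] p = \<ominus> (a [^] p)"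
  using power_p_add[of a "\<ominus> a"] prime_gt_0_nat[OF prime_p]
  by (metis a_inv_closed minus_equality nat_pow_closed nat_pow_zero r_neg a_comm not_gr_zero)

lemma frobenius_fixed_closed [intro, simp]:
  "\<zero> \<in> frobenius_fixed" "\<one> \<in> frobenius_fixed"
  "a \<in> frobenius_fixed \<Longrightarrow> b \<in> frobenius_fixed \<Longrightarrow> a \<oplus> b \<in> frobenius_fixed"
  "a \<in> frobenius_fixed \<Longrightarrow> b \<in> frobenius_fixed \<Longrightarrow> a \<otimes> b \<in> frobenius_fixed"
  "a \<in> frobenius_fixed \<Longrightarrow> \<ominus> a \<in> frobenius_fixed"
  using prime_gt_0_nat[OF prime_p]
  by (auto simp: frobenius_fixed_def power_p_add power_p_minus nat_pow_zero nat_pow_distrib)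

lemma frobenius_fixed_inv:
  assumes "a \<in> frobenius_fixed" "a \<noteq> \<zero>"
  shows "inv a \<in> frobenius_fixed"
proof -
  have a: "a \<in> carrier F" "a [^] p = a" "a \<in> Units F"
    using assms field_Units by (auto simp: frobenius_fixed_def)
  have "inv a [^] p \<otimes> a = (inv a \<otimes> a) [^] p"
    using a by (simp add: nat_pow_distrib del: Units_l_inv)
  then have "inv a [^] p \<otimes> a = \<one>" using a by simp
  then have "inv a [^] p = inv a" using a by (metis Units_inv_closed comm_inv_char m_comm nat_pow_closed)
  then show ?thesis using a by (simp add: frobenius_fixed_def)
qed

text \<open>Apart from zero, fixed points satisfy \<open>x^(p-1) = 1\<close>, which has at most
  \<open>p - 1\<close> solutions.\<close>

lemma card_frobenius_fixed: "card frobenius_fixed \<le> p"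
proof -
  have p1: "p > 1" by (rule prime_gt_1_nat[OF prime_p])
  have "x [^] (p - 1) = \<one>" if x: "x \<in> carrier F" "x [^] p = x" "x \<noteq> \<zero>" for x
  proof -
    have "x [^] (p - 1) \<otimes> x = \<one> \<otimes> x" using x p1 nat_pow_Suc[of x "p - 1"] by simp
    then show ?thesis using x by (metis m_rcancel nat_pow_closed one_closed)
  qed
  then have "frobenius_fixed \<subseteq> insert \<zero> {x \<in> carrier F. x [^] (p - 1) = \<one>}"
    by (auto simp: frobenius_fixed_def)
  then have "card frobenius_fixed \<le> card (insert \<zero> {x \<in> carrier F. x [^] (p - 1) = \<one>})"
    using finite_carrier by (intro card_mono) auto
  also have "\<dots> \<le> Suc (p - 1)"
    using num_roots_le_deg[OF finite_carrier, of "p - 1"] p1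
    by (intro order.trans[OF card_insert_le_m1]) auto
  finally show ?thesis using p1 by simp
qed

section \<open>Counting the solutions of Moebius relations\<close>

lemma card_roots_linear:
  assumes "a \<in> carrier F" "b \<in> carrier F"
  shows "card {x \<in> carrier F. x [^] p = a \<otimes> x \<oplus> b} \<le> p"
proof -
  interpret U: UP_domain F "UP F" by unfold_locales
  have p1: "p > 1" by (rule prime_gt_1_nat[OF prime_p])
  let ?f = "up_ring.monom (UP F) (\<ominus> a) 1 \<oplus>\<^bsub>UP F\<^esub> up_ring.monom (UP F) (\<ominus> b) 0"
  have "deg F ?f \<le> 1" using assms by (intro U.deg_aboveI) auto
  moreover have "{x \<in> carrier F. x [^] p \<oplus> UnivPoly.eval F F id x ?f = \<zero>} = {x \<in> carrier F. x [^] p = a \<otimes> x \<oplus> b}"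
  proof -
    have "x [^] p \<oplus> (\<ominus> a \<otimes> x \<oplus> \<ominus> b) = \<zero> \<longleftrightarrow> x [^] p = a \<otimes> x \<oplus> b" if "x \<in> carrier F" for x
    proof -
      have "x [^] p \<oplus> (\<ominus> a \<otimes> x \<oplus> \<ominus> b) = x [^] p \<ominus> (a \<otimes> x \<oplus> b)"
        using that assms nat_pow_closed[of x p] by algebra
      then show ?thesis using that assms by simp
    qed
    then show ?thesis using assms
      by (intro Collect_cong conj_cong refl) (simp add: U.evalRR_simps del: U.monom_a_inv)
  qed
  ultimately show ?thesis using card_monic_roots[OF finite_carrier, of ?f p] p1 assms by auto
qed

text \<open>Expanded, the relation says that \<open>x\<close> is a root of the monic polynomial
  \<open>X^(p+1) + d X^p - a X - b\<close>.\<close>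

lemma card_roots_moebius:
  assumes "a \<in> carrier F" "b \<in> carrier F" "d \<in> carrier F"
  shows "card {x \<in> carrier F. (x \<oplus> d) \<otimes> x [^] p = a \<otimes> x \<oplus> b} \<le> p + 1"
proof -
  interpret U: UP_domain F "UP F" by unfold_locales
  have p1: "p > 1" by (rule prime_gt_1_nat[OF prime_p])
  let ?f = "up_ring.monom (UP F) d p \<oplus>\<^bsub>UP F\<^esub> (up_ring.monom (UP F) (\<ominus> a) 1 \<oplus>\<^bsub>UP F\<^esub> up_ring.monom (UP F) (\<ominus> b) 0)"
  have "deg F ?f \<le> p" using assms p1 by (intro U.deg_aboveI) auto
  moreover have "{x \<in> carrier F. x [^] (p + 1) \<oplus> UnivPoly.eval F F id x ?f = \<zero>}
    = {x \<in> carrier F. (x \<oplus> d) \<otimes> x [^] p = a \<otimes> x \<oplus> b}"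
  proof -
    have "x [^] p \<otimes> x \<oplus> (d \<otimes> x [^] p \<oplus> (\<ominus> a \<otimes> x \<oplus> \<ominus> b)) = (x \<oplus> d) \<otimes> x [^] p \<ominus> (a \<otimes> x \<oplus> b)"
      if "x \<in> carrier F" for x
      using that assms nat_pow_closed[of x p] by algebra
    then show ?thesis using assms by (auto simp: U.evalRR_simps simp del: U.monom_a_inv)
  qed
  ultimately show ?thesis using card_monic_roots[OF finite_carrier, of ?f "p + 1"] assms by auto
qed

text \<open>The excluded relation is \<open>t^p = (a t + b) / (c t + d)\<close> over the prime field
  with the denominator cleared. For the span \<open>V\<close> of \<open>1\<close> and
  \<open>t\<close>, the property implies that no nonzero \<open>e\<close> in \<open>V\<close> has
  \<open>e t^p\<close> in \<open>V\<close>.\<close>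

definition moebius_free :: "'a \<Rightarrow> bool"
  where "moebius_free t \<longleftrightarrow> (\<forall>a \<in> frobenius_fixed. \<forall>b \<in> frobenius_fixed. \<forall>c \<in> frobenius_fixed.
    \<forall>d \<in> frobenius_fixed. (c \<otimes> t \<oplus> d) \<otimes> t [^] p = a \<otimes> t \<oplus> b \<longrightarrow> c = \<zero> \<and> d = \<zero>)"

text \<open>Dividing by \<open>c\<close> if it is nonzero, and otherwise by \<open>d\<close>, brings
  a nontrivial relation into one of the two excluded shapes or into the case of slope zero.\<close>

lemma moebius_freeI:
  assumes t: "t \<in> carrier F" "t \<notin> frobenius_fixed"
    and 1: "\<And>a b d. a \<in> frobenius_fixed \<Longrightarrow> b \<in> frobenius_fixed \<Longrightarrow> d \<in> frobenius_fixed \<Longrightarrow>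
      (t \<oplus> d) \<otimes> t [^] p \<noteq> a \<otimes> t \<oplus> b"
    and 2: "\<And>a b. a \<in> frobenius_fixed \<Longrightarrow> b \<in> frobenius_fixed \<Longrightarrow> a \<noteq> \<zero> \<Longrightarrow> t [^] p \<noteq> a \<otimes> t \<oplus> b"
  shows "moebius_free t"
  unfolding moebius_free_def
proof (intro ballI impI)
  fix a b c d
  assume P: "a \<in> frobenius_fixed" "b \<in> frobenius_fixed" "c \<in> frobenius_fixed" "d \<in> frobenius_fixed"
    and eq: "(c \<otimes> t \<oplus> d) \<otimes> t [^] p = a \<otimes> t \<oplus> b"
  note C = P[THEN frobenius_fixed_carrier]
  have c: "c = \<zero>"
  proof (rule ccontr)
    assume c: "c \<noteq> \<zero>"
    have ci: "inv c \<in> carrier F" "inv c \<otimes> c = \<one>" using c C field_Units by auto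
    have "(t \<oplus> inv c \<otimes> d) \<otimes> t [^] p = (inv c \<otimes> c \<otimes> t \<oplus> inv c \<otimes> d) \<otimes> t [^] p"
      using ci t by simp
    also have "\<dots> = inv c \<otimes> ((c \<otimes> t \<oplus> d) \<otimes> t [^] p)"
      using ci(1) C t nat_pow_closed[OF t(1), of p] by algebra
    also have "\<dots> = (inv c \<otimes> a) \<otimes> t \<oplus> inv c \<otimes> b"
      unfolding eq using ci(1) C t by algebra
    finally show False using 1 P frobenius_fixed_inv[OF P(3) c] by blast
  qed
  moreover have "d = \<zero>"
  proof (rule ccontr)
    assume d: "d \<noteq> \<zero>"
    have di: "inv d \<in> carrier F" "inv d \<otimes> d = \<one>" using d C field_Units by auto
    have P': "inv d \<otimes> a \<in> frobenius_fixed" "inv d \<otimes> b \<in> frobenius_fixed"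
      using P frobenius_fixed_inv[OF P(4) d] by auto
    have "t [^] p = (inv d \<otimes> d) \<otimes> t [^] p" using t di by simp
    also have "\<dots> = inv d \<otimes> ((c \<otimes> t \<oplus> d) \<otimes> t [^] p)"
      using di(1) C t c by (simp add: m_assoc)
    also have "\<dots> = (inv d \<otimes> a) \<otimes> t \<oplus> inv d \<otimes> b"
      unfolding eq using di(1) C t by algebra
    finally have tp: "t [^] p = (inv d \<otimes> a) \<otimes> t \<oplus> inv d \<otimes> b" .
    \<comment> \<open>With slope zero, \<open>t^p\<close> equals some \<open>s = s^p\<close> in the
      prime field, and injectivity of Frobenius gives \<open>t = s\<close>, against the choice of
      \<open>t\<close>.\<close>
    then have "inv d \<otimes> a = \<zero>" using 2[OF P'] by blast
    then have "t [^] p = inv d \<otimes> b" using tp t P' frobenius_fixed_carrier by simp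
    then have "t [^] p = (inv d \<otimes> b) [^] p" using P' by (simp add: frobenius_fixed_def)
    then have "t = inv d \<otimes> b" using power_p_inj t P' frobenius_fixed_carrier by blast
    then show False using t P' by simp
  qed
  ultimately show "c = \<zero> \<and> d = \<zero>" by simp
qed

text \<open>Union bound. If no \<open>t\<close> qualified, \<open>F\<close> would be covered by the
  prime field, by the solutions of at most \<open>p^3\<close> relations with \<open>c = 1\<close>
  (at most \<open>p + 1\<close> each) and by those of at most \<open>(p - 1) p\<close> relations
  with \<open>c = 0\<close>, \<open>d = 1\<close> and nonzero slope (at most \<open>p\<close>
  each).\<close>

lemma ex_moebius_free_ge_5:
  assumes n: "n \<ge> 5"
  obtains t where "t \<in> carrier F" "moebius_free t"
proof (rule ccontr)
  assume "\<not> thesis"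
  then have none: "\<not> moebius_free t" if "t \<in> carrier F" for t using that \<open>\<And>t. t \<in> carrier F \<Longrightarrow> moebius_free t \<Longrightarrow> thesis\<close> by blast
  let ?P = frobenius_fixed
  define A where "A = (\<lambda>(d, a, b). {x \<in> carrier F. (x \<oplus> d) \<otimes> x [^] p = a \<otimes> x \<oplus> b})"
  define B where "B = (\<lambda>(a, b). {x \<in> carrier F. x [^] p = a \<otimes> x \<oplus> b})"
  let ?I = "?P \<times> ?P \<times> ?P" and ?J = "(?P - {\<zero>}) \<times> ?P"
  have p2: "p \<ge> 2" by (rule prime_ge_2_nat[OF prime_p])
  have finP: "finite ?P" using finite_carrier by (simp add: frobenius_fixed_def)
  have "carrier F - ?P \<subseteq> (\<Union>i\<in>?I. A i) \<union> (\<Union>j\<in>?J. B j)"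
  proof
    fix t assume t: "t \<in> carrier F - ?P"
    show "t \<in> (\<Union>i\<in>?I. A i) \<union> (\<Union>j\<in>?J. B j)"
    proof (rule ccontr)
      assume "\<not> ?thesis"
      then have "moebius_free t" using t by (intro moebius_freeI) (auto simp: A_def B_def)
      then show False using none t by blast
    qed
  qed
  then have "card (carrier F - ?P) \<le> card ((\<Union>i\<in>?I. A i) \<union> (\<Union>j\<in>?J. B j))"
    using finP finite_carrier by (intro card_mono) (auto simp: A_def B_def)
  also have "\<dots> \<le> card (\<Union>i\<in>?I. A i) + card (\<Union>j\<in>?J. B j)" by (rule card_Un_le)
  also have "card (\<Union>i\<in>?I. A i) \<le> p * (p * p) * (p + 1)"
  proof -
    have "card (\<Union>i\<in>?I. A i) \<le> (\<Sum>i\<in>?I. card (A i))" using finP by (intro card_UN_le) auto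
    also have "\<dots> \<le> (\<Sum>i\<in>?I. p + 1)"
      by (intro sum_mono) (auto simp: A_def frobenius_fixed_carrier card_roots_moebius[simplified])
    also have "\<dots> = card ?P * (card ?P * card ?P) * (p + 1)" by (simp add: card_cartesian_product)
    also have "\<dots> \<le> p * (p * p) * (p + 1)" using card_frobenius_fixed by (intro mult_mono) auto
    finally show ?thesis .
  qed
  also have "card (\<Union>j\<in>?J. B j) \<le> (p - 1) * p * p"
  proof -
    have "card (\<Union>j\<in>?J. B j) \<le> (\<Sum>j\<in>?J. card (B j))" using finP by (intro card_UN_le) auto
    also have "\<dots> \<le> (\<Sum>j\<in>?J. p)"
      by (intro sum_mono) (auto simp: B_def frobenius_fixed_carrier card_roots_linear)
    also have "\<dots> = (card ?P - 1) * card ?P * p" using finP by (simp add: card_cartesian_product)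
    also have "\<dots> \<le> (p - 1) * p * p" using card_frobenius_fixed by (intro mult_mono) auto
    finally show ?thesis .
  qed
  finally have "card (carrier F - ?P) \<le> p * (p * p) * (p + 1) + (p - 1) * p * p" by simp
  moreover have "card (carrier F - ?P) = p ^ n - card ?P"
    using finP order_F by (subst card_Diff_subset) (auto simp: order_def frobenius_fixed_def)
  ultimately have "p ^ n \<le> p * (p * p) * (p + 1) + (p - 1) * p * p + p"
    using card_frobenius_fixed by linarith
  moreover have "p ^ 5 \<le> p ^ n" using n p2 by (intro power_increasing) auto
  \<comment> \<open>The left side is \<open>p^4 + 2 p^3 - p^2 + p\<close>, and \<open>p = 2\<close>
    gives just \<open>30 < 32\<close>. Written in \<open>k = p - 2\<close>, the difference of the
    two sides has only positive coefficients.\<close>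
  moreover have "p * (p * p) * (p + 1) + (p - 1) * p * p + p < p ^ 5"
  proof -
    obtain k where k: "p = k + 2" using p2 by (metis add.commute le_Suc_ex)
    show ?thesis unfolding k by (simp add: algebra_simps eval_nat_numeral)
  qed
  ultimately show False by linarith
qed

section \<open>Fields of order p^4\<close>

lemma odd_char_double_eq_zero:
  assumes "odd p" "x \<in> carrier F" "x \<oplus> x = \<zero>"
  shows "x = \<zero>"
proof -
  obtain m where m: "p = Suc (2 * m)" using assms(1) by (metis oddE Suc_eq_plus1)
  have "add_pow F (2::nat) x = \<zero>" using assms by (simp add: numeral_2_eq_2)
  then have "add_pow F (2 * m) x = \<zero>"
    using assms(2) add.nat_pow_pow[of x m 2] by simp
  then have "add_pow F p x = x" using assms by (simp add: m)
  then show ?thesis using add_pow_p assms(2) by simp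
qed

lemma power_eq_one_iff:
  assumes "g \<in> carrier F" "g \<noteq> \<zero>"
  shows "g [^] (k :: nat) = \<one> \<longleftrightarrow> group.ord mult_F g dvd k"
  using group.pow_eq_id[OF group_mult(1), of g k] assms by (simp add: group_mult(2))

text \<open>The chosen \<open>t\<close> satisfies \<open>t^(p^2) = -t\<close>. Applying Frobenius
  twice to a relation over the prime field flips the signs of \<open>t\<close> and
  \<open>t^p\<close>, and adding the result to the relation leaves an equation that can be
  refuted.\<close>

lemma ex_moebius_free_odd_4:
  assumes n: "n = 4" and odd: "odd p"
  obtains t where "t \<in> carrier F" "moebius_free t"
proof -
  have p2: "p \<ge> 2" by (rule prime_ge_2_nat[OF prime_p])
  obtain h where h: "p = 2 * h + 1" using odd by (auto elim: oddE)
  have h0: "h > 0" using h p2 by auto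
  obtain g where g: "g \<in> carrier F" "g \<noteq> \<zero>" and ord: "group.ord mult_F g = p ^ 4 - 1"
    using obtains_generator order_F n by metis
  \<comment> \<open>With \<open>p = 2 h + 1\<close> this is \<open>(p^2 + 1) / 2\<close>, so that
    \<open>k (p^2 - 1)\<close> is half the order \<open>p^4 - 1\<close> of \<open>g\<close>.\<close>
  define k where "k = 2 * h ^ 2 + 2 * h + 1"
  define t where "t = g [^] k"
  have t: "t \<in> carrier F" "t \<noteq> \<zero>" using g nat_pow_eq_zeroD by (auto simp: t_def)
  have ord': "p ^ 4 - 1 = 2 * (k * (4 * h * (h + 1)))"
    unfolding h k_def by (simp add: algebra_simps eval_nat_numeral)
  have k0: "k > 0" by (simp add: k_def)
  \<comment> \<open>The order \<open>2 (p^2 - 1)\<close> of \<open>t\<close> exceeds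
    \<open>(p - 1)^2\<close>. This keeps \<open>t^(p-1)\<close> out of the prime field.\<close>
  have ne: "t [^] ((p - 1) * (p - 1)) \<noteq> \<one>"
  proof
    assume "t [^] ((p - 1) * (p - 1)) = \<one>"
    then have "p ^ 4 - 1 dvd k * ((p - 1) * (p - 1))"
      using power_eq_one_iff[OF g] ord g by (simp add: t_def nat_pow_pow)
    then have "p ^ 4 - 1 \<le> k * ((p - 1) * (p - 1))" using k0 h h0 by (intro dvd_imp_le) auto
    then have "k * (8 * h * (h + 1)) \<le> k * (4 * h * h)" unfolding ord' by (simp add: h algebra_simps)
    then show False using k0 h0 by simp
  qed
  \<comment> \<open>\<open>y\<close> is \<open>g^((p^4 - 1) / 2)\<close>, the unit of order two,
    hence \<open>-1\<close>.\<close>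
  define y where "y = t [^] (p * p - 1)"
  have y: "y \<in> carrier F" using t by (simp add: y_def)
  have pp: "p * p - 1 = 4 * h * (h + 1)" by (simp add: h algebra_simps)
  have "y \<otimes> y = \<one>"
    using power_eq_one_iff[OF g] ord g unfolding y_def t_def pp ord'
    by (simp add: nat_pow_pow nat_pow_mult algebra_simps)
  moreover have "y \<noteq> \<one>"
  proof
    assume "y = \<one>"
    then have "p ^ 4 - 1 dvd k * (4 * h * (h + 1))"
      using power_eq_one_iff[OF g] ord g by (simp only: y_def pp t_def nat_pow_pow)
    then have "p ^ 4 - 1 \<le> k * (4 * h * (h + 1))" using k0 h0 by (intro dvd_imp_le) auto
    then show False unfolding ord' using k0 h0 by simp
  qed
  ultimately have "y = \<ominus> \<one>" using square_eq_one y by blast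
  then have "t [^] (p * p) = \<ominus> \<one> \<otimes> t"
    using t p2 nat_pow_Suc[of t "p * p - 1"] by (simp add: y_def)
  then have frob2: "(t [^] p) [^] p = \<ominus> t" using t by (simp add: nat_pow_pow l_minus)
  have tP: "t \<notin> frobenius_fixed"
  proof
    assume "t \<in> frobenius_fixed"
    then have "t \<oplus> t = \<zero>" using frob2 t by (simp add: frobenius_fixed_def) (metis r_neg)
    then show False using odd_char_double_eq_zero[OF odd] t by blast
  qed
  have fx: "a [^] p = a" if "a \<in> frobenius_fixed" for a using that by (simp add: frobenius_fixed_def)
  have tp: "t [^] p \<in> carrier F" "t [^] p \<noteq> \<zero>" using t nat_pow_eq_zeroD by auto
  show ?thesis
  proof (rule that[OF t(1)], rule moebius_freeI[OF t(1) tP])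
    fix a b d
    assume P: "a \<in> frobenius_fixed" "b \<in> frobenius_fixed" "d \<in> frobenius_fixed"
    note C = P[THEN frobenius_fixed_carrier]
    show "(t \<oplus> d) \<otimes> t [^] p \<noteq> a \<otimes> t \<oplus> b"
    proof
      assume eq: "(t \<oplus> d) \<otimes> t [^] p = a \<otimes> t \<oplus> b"
      have "(((t \<oplus> d) \<otimes> t [^] p) [^] p) [^] p = ((a \<otimes> t \<oplus> b) [^] p) [^] p" by (simp add: eq)
      then have eq': "(\<ominus> t \<oplus> d) \<otimes> \<ominus> (t [^] p) = a \<otimes> \<ominus> t \<oplus> b"
        using C t tp by (simp add: power_p_add power_p_minus nat_pow_distrib frob2 fx P)
      \<comment> \<open>In the sum of the relation and its second conjugate the terms with
        \<open>a\<close> and \<open>d\<close> cancel, leaving twice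
        \<open>t t^p - b\<close>.\<close>
      have "(t \<otimes> t [^] p \<ominus> b) \<oplus> (t \<otimes> t [^] p \<ominus> b)
        = ((t \<oplus> d) \<otimes> t [^] p \<ominus> (a \<otimes> t \<oplus> b)) \<oplus> ((\<ominus> t \<oplus> d) \<otimes> \<ominus> (t [^] p) \<ominus> (a \<otimes> \<ominus> t \<oplus> b))"
        using C t(1) tp(1) by algebra
      also have "\<dots> = \<zero>" unfolding eq eq' using C t(1)
        by (simp only: a_minus_def r_neg a_closed m_closed a_inv_closed zero_closed l_zero)
      finally have "t \<otimes> t [^] p \<ominus> b = \<zero>"
        by (rule odd_char_double_eq_zero[OF odd, rotated]) (use C t tp in auto)
      then have b: "t \<otimes> t [^] p = b" using C t(1) tp(1) r_right_minus_eq m_closed by blast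
      \<comment> \<open>Frobenius fixes \<open>b\<close> but sends \<open>t t^p\<close> to
        \<open>t^p (-t)\<close>.\<close>
      then have "t [^] p \<otimes> \<ominus> t = t \<otimes> t [^] p"
        using fx[OF P(2)] t tp frob2 nat_pow_distrib[of t "t [^] p" p] by simp
      then have "t [^] p \<otimes> \<ominus> t = t [^] p \<otimes> t" using t tp m_comm by simp
      then have "\<ominus> t = t" using t tp m_lcancel by blast
      then have "t \<oplus> t = \<zero>" using t by (metis r_neg)
      then show False using odd_char_double_eq_zero[OF odd] t by blast
    qed
  next
    fix a b
    assume P: "a \<in> frobenius_fixed" "b \<in> frobenius_fixed"
    note C = P[THEN frobenius_fixed_carrier]
    show "t [^] p \<noteq> a \<otimes> t \<oplus> b"
    proof
      assume eq: "t [^] p = a \<otimes> t \<oplus> b"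
      \<comment> \<open>The same sign flip cancels the slope term and gives \<open>2 b = 0\<close>.
        Then \<open>t^(p-1) = a\<close> is a nonzero element of the prime field, and
        \<open>a^(p-1) = 1\<close> contradicts the order of \<open>t\<close>.\<close>
      have "((t [^] p) [^] p) [^] p = ((a \<otimes> t \<oplus> b) [^] p) [^] p" by (simp add: eq)
      then have eq': "\<ominus> (t [^] p) = a \<otimes> \<ominus> t \<oplus> b"
        using C t tp by (simp add: power_p_add power_p_minus nat_pow_distrib frob2 fx P)
      have "b \<oplus> b = (a \<otimes> t \<oplus> b) \<oplus> (a \<otimes> \<ominus> t \<oplus> b)" using C t(1) by algebra
      also have "\<dots> = \<zero>" unfolding eq[symmetric] eq'[symmetric] using tp by (simp add: r_neg)
      finally have "b = \<zero>" using odd_char_double_eq_zero[OF odd] C by blast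
      then have "t [^] (p - 1) \<otimes> t = a \<otimes> t"
        using eq C t p2 nat_pow_Suc[of t "p - 1"] by simp
      then have a: "t [^] (p - 1) = a" using t C m_rcancel by (metis nat_pow_closed)
      have "a \<noteq> \<zero>" using a t nat_pow_eq_zeroD by blast
      have "a [^] (p - 1) \<otimes> a = \<one> \<otimes> a"
        using fx[OF P(1)] C p2 nat_pow_Suc[of a "p - 1"] by simp
      then have "a [^] (p - 1) = \<one>" using \<open>a \<noteq> \<zero>\<close> C m_rcancel by (metis nat_pow_closed one_closed)
      then show False using ne t by (simp add: a[symmetric] nat_pow_pow)
    qed
  qed
qed

text \<open>Any generator \<open>t\<close> of the unit group, of order \<open>15\<close>, works. A
  normalized relation over the two-element field reads \<open>t^2 = t + b\<close> or
  \<open>t^3 = d t^2 + a t + b\<close>, and each forces \<open>t = 0\<close> or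
  \<open>t^k = 1\<close> with \<open>k\<close> among \<open>1, 2, 3, 4, 7\<close>.\<close>

lemma ex_moebius_free_even_4:
  assumes n: "n = 4" and p: "p = 2"
  obtains t where "t \<in> carrier F" "moebius_free t"
proof -
  obtain t where t: "t \<in> carrier F" "t \<noteq> \<zero>" and ord: "group.ord mult_F t = 15"
    using obtains_generator order_F n p by auto
  have pow: "t [^] k \<noteq> \<one>" if "\<not> 15 dvd k" for k :: nat
    using power_eq_one_iff[OF t, of k] that by (simp add: ord)
  have dbl: "x \<oplus> x = \<zero>" if "x \<in> carrier F" for x
    using add_pow_p[OF that] that by (simp add: p numeral_2_eq_2)
  have dbl': "x \<oplus> (x \<oplus> y) = y" if "x \<in> carrier F" "y \<in> carrier F" for x y
    using dbl[of x] that by (simp flip: a_assoc)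
  have pw: "t [^] (2::nat) = t \<otimes> t" "t [^] (3::nat) = t \<otimes> (t \<otimes> t)" using t by (simp_all add: eval_nat_numeral m_assoc)
  have t1: "t \<noteq> \<one>" using pow[of 1] t by simp
  have tt: "t \<otimes> t \<noteq> t"
  proof
    assume "t \<otimes> t = t"
    then have "t \<otimes> t = t \<otimes> \<one>" using t by simp
    then show False using t t1 m_lcancel[of t t \<one>] by simp
  qed
  have P: "frobenius_fixed = {\<zero>, \<one>}"
  proof -
    have "x = \<zero> \<or> x = \<one>" if "x \<in> frobenius_fixed" for x
    proof (rule disjCI)
      assume "x \<noteq> \<one>"
      have x: "x \<in> carrier F" using that by (rule frobenius_fixed_carrier)
      have "x [^] p = x" using that by (simp add: frobenius_fixed_def)
      then have "x \<otimes> x = x" using x by (simp add: p numeral_2_eq_2)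
      then have "x \<otimes> (x \<ominus> \<one>) = \<zero>" using x by (simp add: a_minus_def r_distr r_minus r_neg)
      then show "x = \<zero>" using x \<open>x \<noteq> \<one>\<close> by (simp add: integral_iff)
    qed
    then have "frobenius_fixed \<subseteq> {\<zero>, \<one>}" by (intro subsetI) simp
    then show ?thesis by auto
  qed
  show ?thesis
  proof (rule that[OF t(1)], rule moebius_freeI[OF t(1)])
    show "t \<notin> frobenius_fixed" using t pow[of 1] by (auto simp: P)
  next
    fix a b
    assume ab: "a \<in> frobenius_fixed" "b \<in> frobenius_fixed" "a \<noteq> \<zero>"
    show "t [^] p \<noteq> a \<otimes> t \<oplus> b"
    proof
      assume "t [^] p = a \<otimes> t \<oplus> b"
      moreover have "a = \<one>" using ab by (simp add: P)
      ultimately have "t \<otimes> t = t \<oplus> b" using t by (simp add: p pw)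
      then have "t \<otimes> (t \<otimes> t) = \<one>" using ab t tt
        by (auto simp: P r_distr dbl' a_ac)
      then show False using pow[of 3] by (simp add: pw)
    qed
  next
    fix a b d
    assume abd: "a \<in> frobenius_fixed" "b \<in> frobenius_fixed" "d \<in> frobenius_fixed"
    show "(t \<oplus> d) \<otimes> t [^] p \<noteq> a \<otimes> t \<oplus> b"
    proof
      assume "(t \<oplus> d) \<otimes> t [^] p = a \<otimes> t \<oplus> b"
      then have eq: "(t \<oplus> d) \<otimes> (t \<otimes> t) = a \<otimes> t \<oplus> b" by (simp add: p pw)
      define u where "u = t \<otimes> t"
      have u: "u \<in> carrier F" using t by (simp add: u_def)
      have "t \<otimes> u = (t \<oplus> d) \<otimes> u \<oplus> d \<otimes> u"
        using abd t u by (auto simp: P l_distr a_assoc dbl)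
      then have t3: "t \<otimes> u = a \<otimes> t \<oplus> b \<oplus> d \<otimes> u" unfolding eq[folded u_def] .
      have tu: "t \<otimes> t = u" by (simp add: u_def)
      \<comment> \<open>The choices of \<open>a\<close>, \<open>b\<close>, \<open>d\<close> run
        through the eight monic cubics over the two-element field. The irreducible ones,
        \<open>X^3 + X + 1\<close> and \<open>X^3 + X^2 + 1\<close>, give \<open>t^7 = 1\<close>;
        \<open>X^3\<close> would make \<open>t\<close> zero, and the rest give
        \<open>t^k = 1\<close> with \<open>k \<le> 4\<close>.\<close>
      have "t = \<one> \<or> t \<otimes> t = \<one> \<or> t \<otimes> u = \<one> \<or> t \<otimes> (t \<otimes> u) = \<one> \<or> (t \<otimes> u) \<otimes> (t \<otimes> (t \<otimes> u)) = \<one>"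
      proof -
        consider "a = \<zero>" "b = \<zero>" "d = \<zero>" | "a = \<zero>" "b = \<one>" "d = \<zero>"
          | "a = \<one>" "b = \<zero>" "d = \<zero>" | "a = \<one>" "b = \<one>" "d = \<zero>"
          | "a = \<zero>" "b = \<zero>" "d = \<one>" | "a = \<zero>" "b = \<one>" "d = \<one>"
          | "a = \<one>" "b = \<zero>" "d = \<one>" | "a = \<one>" "b = \<one>" "d = \<one>"
          using abd by (auto simp: P)
        then show ?thesis
        proof cases
          case 1
          then show ?thesis using t3 t u by (simp add: integral_iff) (simp add: u_def integral_iff)
        next
          case 2
          then show ?thesis using t3 t u by simp
        next
          case 3
          then have "t \<otimes> u = t \<otimes> \<one>" using t3 t u by simp
          then have "u = \<one>" using t u m_lcancel by blast
          then show ?thesis by (simp add: u_def)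
        next
          case 4
          then have *: "t \<otimes> u = t \<oplus> \<one>" using t3 t u by simp
          have "(t \<otimes> u) \<otimes> (t \<otimes> (t \<otimes> u)) = \<one>"
            using t u by (simp add: * l_distr r_distr tu dbl dbl' a_ac)
          then show ?thesis by blast
        next
          case 5
          then have "u \<otimes> t = u \<otimes> \<one>" using t3 t u by (simp add: m_comm)
          moreover have "u \<noteq> \<zero>" using t by (simp add: u_def integral_iff)
          ultimately show ?thesis using t u m_lcancel by blast
        next
          case 6
          then have *: "t \<otimes> u = \<one> \<oplus> u" using t3 t u by simp
          have **: "u \<otimes> u = u \<oplus> t \<oplus> \<one>"
          proof -
            have "u \<otimes> u = t \<otimes> (t \<otimes> u)" using t by (simp add: u_def m_assoc)
            then show ?thesis using t u by (simp add: * r_distr a_ac)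
          qed
          have "(t \<otimes> u) \<otimes> (t \<otimes> (t \<otimes> u)) = \<one>"
            using t u by (simp add: * ** l_distr r_distr m_comm[of u t] dbl dbl' a_ac)
          then show ?thesis by blast
        next
          case 7
          then have "t \<otimes> u = t \<otimes> (\<one> \<oplus> t)" using t3 t u by (simp add: r_distr tu)
          then have "u = \<one> \<oplus> t" using t u m_lcancel by blast
          then have "t \<otimes> u = \<one>" using 7 t3 t u by (simp add: dbl dbl' a_ac)
          then show ?thesis by blast
        next
          case 8
          then have *: "t \<otimes> u = t \<oplus> \<one> \<oplus> u" using t3 t u by simp
          have "t \<otimes> (t \<otimes> u) = \<one>" using t u by (simp add: * r_distr tu dbl dbl' a_ac)
          then show ?thesis by blast
        qed
      qed
      moreover have "t [^] (4::nat) = t \<otimes> (t \<otimes> u)" "t [^] (7::nat) = (t \<otimes> u) \<otimes> (t \<otimes> (t \<otimes> u))"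
        using t by (simp_all add: eval_nat_numeral u_def m_assoc)
      ultimately show False
        using pow[of 1] pow[of 2] pow[of 3] pow[of 4] pow[of 7] t by (auto simp: pw u_def)
    qed
  qed
qed

lemma ex_moebius_free:
  assumes "n \<ge> 4"
  obtains t where "t \<in> carrier F" "moebius_free t"
proof -
  have "n \<ge> 5 \<or> n = 4 \<and> odd p \<or> n = 4 \<and> p = 2"
    using assms primes_dvd_imp_eq[OF two_is_prime_nat prime_p] by auto
  then show ?thesis
    using ex_moebius_free_ge_5 ex_moebius_free_odd_4 ex_moebius_free_even_4 that by metis
qed

end

section \<open>Automorphisms of quotient rings\<close>

lemma ring_auto_iso: "f \<in> ring_auto R \<Longrightarrow> f \<in> ring_iso R R"
  by (simp add: ring_auto_def ring_iso_def Bij_def)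

lemma (in ring) ring_iso_restrict_auto:
  assumes "f \<in> ring_iso R R"
  shows "restrict f (carrier R) \<in> ring_auto R"
  using assms by (auto simp: ring_auto_def ring_iso_def ring_hom_def Bij_def Pi_iff)

lemma (in ring) aut_fixed_ring_iff:
  "x \<in> aut_fixed_ring R \<longleftrightarrow> x \<in> carrier R \<and> (\<forall>f \<in> ring_iso R R. f x = x)"
  using ring_iso_restrict_auto ring_auto_iso by (fastforce simp: aut_fixed_ring_def)

text \<open>The witness is the conjugate of \<open>g\<close> by \<open>\<psi>\<close>, left
  unrestricted outside the carrier and therefore stated as a \<open>ring_iso\<close>.\<close>

lemma (in ring) ring_auto_pullback:
  assumes \<psi>: "\<psi> \<in> ring_iso R S" and g: "g \<in> ring_auto S"
  obtains f where "f \<in> ring_iso R R" "\<And>x. x \<in> carrier R \<Longrightarrow> g (\<psi> x) = \<psi> (f x)"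
proof
  let ?f = "inv_into (carrier R) \<psi> \<circ> (g \<circ> \<psi>)"
  have bij: "bij_betw \<psi> (carrier R) (carrier S)" using \<psi> by (rule ring_iso_memE)
  have g': "g \<in> ring_iso S S" using g by (rule ring_auto_iso)
  show "?f \<in> ring_iso R R"
    using ring_iso_set_trans[OF ring_iso_set_trans[OF \<psi> g'] ring_iso_set_sym[OF ring_axioms \<psi>]] .
  show "g (\<psi> x) = \<psi> (?f x)" if "x \<in> carrier R" for x
    using bij_betw_inv_into_right[OF bij] ring_iso_memE(1)[OF g'] ring_iso_memE(1)[OF \<psi>] that by simp
qed

lemma (in ring) ring_auto_pushforward:
  assumes S: "ring S" and \<psi>: "\<psi> \<in> ring_iso R S" and f: "f \<in> ring_iso R R"
  obtains g where "g \<in> ring_auto S" "\<And>x. x \<in> carrier R \<Longrightarrow> g (\<psi> x) = \<psi> (f x)"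
proof
  let ?g = "restrict (\<psi> \<circ> f \<circ> inv_into (carrier R) \<psi>) (carrier S)"
  have bij: "bij_betw \<psi> (carrier R) (carrier S)" using \<psi> by (rule ring_iso_memE)
  show "?g \<in> ring_auto S"
    using ring_iso_set_trans[OF ring_iso_set_sym[OF ring_axioms \<psi>] ring_iso_set_trans[OF f \<psi>]]
    by (intro ring.ring_iso_restrict_auto[OF S])
  show "?g (\<psi> x) = \<psi> (f x)" if "x \<in> carrier R" for x
    using bij_betw_inv_into_left[OF bij that] ring_iso_memE(1)[OF \<psi> that] by simp
qed

lemma (in ring) zero_coset: "x \<in> carrier R \<Longrightarrow> {\<zero>} +> x = {x}"
  by (auto simp: a_r_coset_def')

lemma (in ring) singleton_ring_iso: "(\<lambda>x. {x}) \<in> ring_iso R (R Quot {\<zero>})"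
proof -
  interpret Z: ideal "{\<zero>}" R by (rule zeroideal)
  have "(+>) {\<zero>} \<in> ring_hom R (R Quot {\<zero>})" by (rule Z.rcos_ring_hom)
  then have "(\<lambda>x. {x}) \<in> ring_hom R (R Quot {\<zero>})"
    by (auto simp: ring_hom_def zero_coset Pi_iff)
  moreover have "carrier (R Quot {\<zero>}) = (\<lambda>x. {x}) ` carrier R"
    by (auto simp: FactRing_def A_RCOSETS_def' zero_coset)
  ultimately show ?thesis by (auto simp: ring_iso_def bij_betw_def)
qed

text \<open>Transport along \<open>x \<mapsto> {x}\<close> replaces the group of the zero ideal and
  its action by plain automorphisms of \<open>R\<close>. \<open>Q\<close> is arbitrary so that the
  coset condition of a covering ideal can be inserted.\<close>

lemma (in ring) ex_top_stabilizer_iff: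
  assumes M: "M \<subseteq> carrier R"
  shows "(\<exists>h \<in> setwise_stabilizer (aut_groups R {\<zero>}) (top_action R aut_actions) M.
            \<forall>x \<in> M. Q x (top_action R aut_actions h x)) \<longleftrightarrow>
         (\<exists>f \<in> ring_iso R R. f ` M = M \<and> (\<forall>x \<in> M. Q x (f x)))" (is "?L \<longleftrightarrow> ?R")
proof
  assume ?L
  then obtain h where h: "h \<in> ring_auto (R Quot {\<zero>})" "top_action R aut_actions h ` M = M"
    and Q: "\<forall>x \<in> M. Q x (top_action R aut_actions h x)"
    by (auto simp: setwise_stabilizer_def aut_groups_def RingAutoGroup_def)
  obtain f where f: "f \<in> ring_iso R R" "\<And>x. x \<in> carrier R \<Longrightarrow> h {x} = {f x}"
    using ring_auto_pullback[OF singleton_ring_iso h(1)] by auto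
  have "top_action R aut_actions h x = f x" if "x \<in> M" for x
    using f(2)[of x] that M by (auto simp: top_action_def aut_actions_def zero_coset)
  then show ?R using f(1) h(2) Q by (metis (no_types, lifting) image_cong)
next
  assume ?R
  then obtain f where f: "f \<in> ring_iso R R" "f ` M = M" and Q: "\<forall>x \<in> M. Q x (f x)" by blast
  obtain h where h: "h \<in> ring_auto (R Quot {\<zero>})" "\<And>x. x \<in> carrier R \<Longrightarrow> h {x} = {f x}"
    using ring_auto_pushforward[OF ideal.quotient_is_ring[OF zeroideal] singleton_ring_iso f(1)] by auto
  have *: "top_action R aut_actions h x = f x" if "x \<in> M" for x
    using h(2)[of x] that M by (auto simp: top_action_def aut_actions_def zero_coset)
  then have "top_action R aut_actions h ` M = M" using f(2) by (metis (no_types, lifting) image_cong)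
  then show ?L using h(1) Q *
    by (intro bexI[of _ h]) (auto simp: setwise_stabilizer_def aut_groups_def RingAutoGroup_def)
qed

section \<open>Dual numbers over a finite field\<close>

text \<open>\<open>E a b\<close> stands for \<open>a + b \<epsilon>\<close> with
  \<open>\<epsilon>^2 = 0\<close>. The coordinate map keeps polynomial quotients out of the main
  argument.\<close>

locale dual_numbers = prime_power_field F p n + R: cring R
  for F :: "('a, 'b) ring_scheme" (structure) and p n and R :: "('c, 'd) ring_scheme" +
  fixes E :: "'a \<Rightarrow> 'a \<Rightarrow> 'c"
  assumes E_bij: "bij_betw (\<lambda>(a, b). E a b) (carrier F \<times> carrier F) (carrier R)"
    and E_add: "\<lbrakk>a \<in> carrier F; b \<in> carrier F; c \<in> carrier F; d \<in> carrier F\<rbrakk> \<Longrightarrow>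
      E a b \<oplus>\<^bsub>R\<^esub> E c d = E (a \<oplus> c) (b \<oplus> d)"
    and E_mult: "\<lbrakk>a \<in> carrier F; b \<in> carrier F; c \<in> carrier F; d \<in> carrier F\<rbrakk> \<Longrightarrow>
      E a b \<otimes>\<^bsub>R\<^esub> E c d = E (a \<otimes> c) (a \<otimes> d \<oplus> b \<otimes> c)"
    and E_one: "\<one>\<^bsub>R\<^esub> = E \<one> \<zero>"
begin

lemma E_closed [simp]: "a \<in> carrier F \<Longrightarrow> b \<in> carrier F \<Longrightarrow> E a b \<in> carrier R"
  using bij_betw_apply[OF E_bij, of "(a, b)"] by simp

lemma E_inject:
  "\<lbrakk>a \<in> carrier F; b \<in> carrier F; c \<in> carrier F; d \<in> carrier F\<rbrakk> \<Longrightarrow> E a b = E c d \<longleftrightarrow> a = c \<and> b = d"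
  using inj_onD[OF bij_betw_imp_inj_on[OF E_bij], of "(a, b)" "(c, d)"] by auto

lemma E_cases:
  assumes "x \<in> carrier R"
  obtains a b where "a \<in> carrier F" "b \<in> carrier F" "x = E a b"
proof -
  have "x \<in> (\<lambda>(a, b). E a b) ` (carrier F \<times> carrier F)"
    using assms by (simp add: bij_betw_imp_surj_on[OF E_bij])
  then show ?thesis using that by auto
qed

lemma E_zero: "\<zero>\<^bsub>R\<^esub> = E \<zero> \<zero>"
proof -
  have "E \<zero> \<zero> \<oplus>\<^bsub>R\<^esub> E \<zero> \<zero> = E \<zero> \<zero>" by (simp add: E_add)
  then show ?thesis using R.add.r_cancel_one[of "E \<zero> \<zero>" "E \<zero> \<zero>"] by simp
qed

lemma E_minus: "a \<in> carrier F \<Longrightarrow> b \<in> carrier F \<Longrightarrow> \<ominus>\<^bsub>R\<^esub> E a b = E (\<ominus> a) (\<ominus> b)"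
  by (rule R.minus_equality) (simp_all add: E_add E_zero l_neg)

lemma E_power_fst: "a \<in> carrier F \<Longrightarrow> E a \<zero> [^]\<^bsub>R\<^esub> (k :: nat) = E (a [^] k) \<zero>"
  by (induction k) (simp_all add: E_one E_mult)

lemma E_power_unipotent: "b \<in> carrier F \<Longrightarrow> E \<one> b [^]\<^bsub>R\<^esub> (k :: nat) = E \<one> (add_pow F k b)"
  by (induction k) (simp_all add: E_one E_mult a_comm)

section \<open>The only proper nonzero ideal\<close>

definition eps_ideal :: "'c set"
  where "eps_ideal = E \<zero> ` carrier F"

lemma E_in_eps_ideal:
  "a \<in> carrier F \<Longrightarrow> b \<in> carrier F \<Longrightarrow> E a b \<in> eps_ideal \<longleftrightarrow> a = \<zero>"
  by (auto simp: eps_ideal_def E_inject image_iff)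

lemma ideal_eps_ideal: "ideal eps_ideal R"
proof (rule idealI)
  show "subgroup eps_ideal (add_monoid R)"
  proof (rule R.add.subgroupI)
    show "\<ominus>\<^bsub>R\<^esub> x \<in> eps_ideal" if "x \<in> eps_ideal" for x
      using that by (auto simp: eps_ideal_def E_minus)
  qed (auto simp: eps_ideal_def E_add)
  show "x \<otimes>\<^bsub>R\<^esub> y \<in> eps_ideal" "y \<otimes>\<^bsub>R\<^esub> x \<in> eps_ideal" if "y \<in> eps_ideal" "x \<in> carrier R" for x y
    using that by (auto simp: eps_ideal_def E_mult elim!: E_cases)
qed (rule R.ring_axioms)

lemma eps_ideal_proper: "eps_ideal \<noteq> carrier R" "eps_ideal \<noteq> {\<zero>\<^bsub>R\<^esub>}"
proof -
  have "E \<one> \<zero> \<in> carrier R - eps_ideal" by (simp add: E_in_eps_ideal)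
  then show "eps_ideal \<noteq> carrier R" by blast
  have "E \<zero> \<one> \<in> eps_ideal" "E \<zero> \<one> \<noteq> E \<zero> \<zero>" by (simp_all add: E_in_eps_ideal E_inject)
  then show "eps_ideal \<noteq> {\<zero>\<^bsub>R\<^esub>}" unfolding E_zero by blast
qed

text \<open>An element with nonzero constant term is a unit, so a proper ideal lies in
  \<open>(\<epsilon>)\<close>; conversely any nonzero \<open>b \<epsilon>\<close> generates
  \<open>(\<epsilon>)\<close>.\<close>

lemma proper_nonzero_ideal:
  assumes I: "ideal I R" and "I \<noteq> carrier R" "I \<noteq> {\<zero>\<^bsub>R\<^esub>}"
  shows "I = eps_ideal"
proof -
  interpret I: ideal I R by (rule I)
  have sub: "I \<subseteq> eps_ideal"
  proof
    fix x assume x: "x \<in> I"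
    then obtain a b where ab: "a \<in> carrier F" "b \<in> carrier F" "x = E a b"
      using E_cases I.a_subset by blast
    have "a = \<zero>"
    proof (rule ccontr)
      assume "a \<noteq> \<zero>"
      then have ai: "inv a \<in> carrier F" "a \<otimes> inv a = \<one>" using ab field_Units by auto
      \<comment> \<open>The second factor is the inverse \<open>a^-1 - a^-2 b \<epsilon>\<close> of
        \<open>x\<close>.\<close>
      have "x \<otimes>\<^bsub>R\<^esub> E (inv a) (\<ominus> (inv a \<otimes> inv a \<otimes> b)) = E \<one> (a \<otimes> \<ominus> (inv a \<otimes> inv a \<otimes> b) \<oplus> b \<otimes> inv a)"
        using ab ai by (simp add: E_mult)
      also have "a \<otimes> \<ominus> (inv a \<otimes> inv a \<otimes> b) \<oplus> b \<otimes> inv a = \<ominus> ((a \<otimes> inv a) \<otimes> inv a \<otimes> b) \<oplus> b \<otimes> inv a"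
        using ab ai(1) by algebra
      also have "\<dots> = \<zero>" unfolding ai(2) using ab ai(1) by algebra
      finally have "\<one>\<^bsub>R\<^esub> \<in> I" using I.I_r_closed[OF x] ab ai by (metis E_one E_closed a_inv_closed m_closed)
      then show False using I.one_imp_carrier assms(2) by blast
    qed
    then show "x \<in> eps_ideal" using ab by (simp add: E_in_eps_ideal)
  qed
  obtain b where b: "b \<in> carrier F" "E \<zero> b \<in> I" "E \<zero> b \<noteq> \<zero>\<^bsub>R\<^esub>"
  proof -
    obtain x where "x \<in> I" "x \<noteq> \<zero>\<^bsub>R\<^esub>"
      using assms(3) additive_subgroup.zero_closed[OF I.additive_subgroup_axioms] by blast
    moreover then obtain b where "b \<in> carrier F" "x = E \<zero> b" using sub by (auto simp: eps_ideal_def)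
    ultimately show ?thesis using that by blast
  qed
  then have b0: "b \<noteq> \<zero>" by (auto simp: E_zero)
  then have bi: "inv b \<in> carrier F" "b \<otimes> inv b = \<one>" using b field_Units by auto
  have "eps_ideal \<subseteq> I"
  proof
    fix x assume "x \<in> eps_ideal"
    then obtain c where c: "c \<in> carrier F" "x = E \<zero> c" by (auto simp: eps_ideal_def)
    have "E \<zero> b \<otimes>\<^bsub>R\<^esub> E (inv b \<otimes> c) \<zero> = x" using b bi c by (simp add: E_mult flip: m_assoc)
    then show "x \<in> I" using I.I_r_closed[OF b(2)] bi c by (metis E_closed m_closed zero_closed)
  qed
  with sub show ?thesis by blast
qed

section \<open>The residue field and lifts of its automorphisms\<close>

definition proj :: "'a \<Rightarrow> 'c set"
  where "proj a = eps_ideal +>\<^bsub>R\<^esub> E a \<zero>"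

lemma coset_eq_iff:
  assumes "a \<in> carrier F" "b \<in> carrier F" "c \<in> carrier F" "d \<in> carrier F"
  shows "eps_ideal +>\<^bsub>R\<^esub> E a b = eps_ideal +>\<^bsub>R\<^esub> E c d \<longleftrightarrow> a = c"
proof -
  have "E a b \<ominus>\<^bsub>R\<^esub> E c d = E (a \<ominus> c) (b \<ominus> d)"
    using assms by (simp add: R.minus_eq E_minus E_add minus_eq)
  then show ?thesis
    using R.quotient_eq_iff_same_a_r_cos[OF ideal_eps_ideal, of "E a b" "E c d"] assms
    by (simp add: E_in_eps_ideal)
qed

lemma coset_E: "a \<in> carrier F \<Longrightarrow> b \<in> carrier F \<Longrightarrow> eps_ideal +>\<^bsub>R\<^esub> E a b = proj a"
  by (simp add: proj_def coset_eq_iff)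

lemma proj_iso: "proj \<in> ring_iso F (R Quot eps_ideal)"
proof -
  have "(\<lambda>a. E a \<zero>) \<in> ring_hom F R" by (rule ring_hom_memI) (auto simp: E_mult E_add E_one)
  then have "(+>\<^bsub>R\<^esub>) eps_ideal \<circ> (\<lambda>a. E a \<zero>) \<in> ring_hom F (R Quot eps_ideal)"
    using ideal.rcos_ring_hom[OF ideal_eps_ideal] by (rule ring_hom_trans)
  then have "proj \<in> ring_hom F (R Quot eps_ideal)" by (simp add: proj_def[abs_def] comp_def)
  moreover have "inj_on proj (carrier F)" by (rule inj_onI) (simp add: proj_def coset_eq_iff)
  moreover have "proj ` carrier F = carrier (R Quot eps_ideal)"
  proof -
    have "Y \<in> proj ` carrier F" if "Y \<in> carrier (R Quot eps_ideal)" for Y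
      using that by (auto simp: FactRing_def A_RCOSETS_def' coset_E elim!: E_cases)
    moreover have "proj ` carrier F \<subseteq> carrier (R Quot eps_ideal)"
      using ring_hom_memE(1)[OF \<open>proj \<in> ring_hom F (R Quot eps_ideal)\<close>] by blast
    ultimately show ?thesis by blast
  qed
  ultimately show ?thesis by (simp add: ring_iso_def bij_betw_def)
qed

text \<open>As \<open>\<epsilon>^2 = 0\<close>, the \<open>\<epsilon>\<close>-part of a product is
  linear in those of the factors, so scaling it by \<open>c\<close> is compatible with
  multiplication. On a finite ring injectivity gives bijectivity.\<close>

lemma obtain_automorphism:
  assumes s: "s \<in> ring_iso F F" and c: "c \<in> carrier F" "c \<noteq> \<zero>"
  obtains f where "f \<in> ring_iso R R"
    "\<And>a b. a \<in> carrier F \<Longrightarrow> b \<in> carrier F \<Longrightarrow> f (E a b) = E (s a) (c \<otimes> s b)"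
proof -
  define g where "g = inv_into (carrier F \<times> carrier F) (\<lambda>(a, b). E a b)"
  define f where "f = (\<lambda>x. E (s (fst (g x))) (c \<otimes> s (snd (g x))))"
  have g: "g (E a b) = (a, b)" if "a \<in> carrier F" "b \<in> carrier F" for a b
    using bij_betw_inv_into_left[OF E_bij, of "(a, b)"] that by (simp add: g_def)
  have f: "f (E a b) = E (s a) (c \<otimes> s b)" if "a \<in> carrier F" "b \<in> carrier F" for a b
    using g[OF that] by (simp add: f_def)
  note s_simps = ring_iso_memE(1-4)[OF s]
  have s0: "s \<zero> = \<zero>"
    using ring_hom_zero[OF _ ring_axioms ring_axioms] s by (simp add: ring_iso_def)
  have inj: "s a = s b \<longleftrightarrow> a = b" if "a \<in> carrier F" "b \<in> carrier F" for a b
    using bij_betw_imp_inj_on[OF ring_iso_memE(5)[OF s]] that by (auto simp: inj_on_def)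
  have "f \<in> ring_iso R R"
  proof (rule ring_iso_memI)
    have fin: "finite (carrier R)" using bij_betw_finite[OF E_bij] finite_carrier by simp
    have inj_f: "inj_on f (carrier R)"
    proof (rule inj_onI)
      fix x y assume x: "x \<in> carrier R" and y: "y \<in> carrier R" and eq: "f x = f y"
      obtain a b where ab: "a \<in> carrier F" "b \<in> carrier F" "x = E a b" using E_cases[OF x] .
      obtain a' b' where ab': "a' \<in> carrier F" "b' \<in> carrier F" "y = E a' b'" using E_cases[OF y] .
      have "s a = s a'" "c \<otimes> s b = c \<otimes> s b'"
        using eq ab ab' c s_simps by (simp_all add: f E_inject)
      then show "x = y" using ab ab' inj c s_simps(1) by (simp add: m_lcancel)
    qed
    have "f ` carrier R \<subseteq> carrier R"
      using c s_simps by (auto simp: f elim!: E_cases)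
    then have "f ` carrier R = carrier R" using inj_f by (rule endo_inj_surj[OF fin])
    with inj_f show "bij_betw f (carrier R) (carrier R)" unfolding bij_betw_def by (rule conjI)
    show "f \<one>\<^bsub>R\<^esub> = \<one>\<^bsub>R\<^esub>" using c s_simps by (simp add: E_one f s0)
  next
    fix x y assume x: "x \<in> carrier R" and y: "y \<in> carrier R"
    obtain a b where ab: "a \<in> carrier F" "b \<in> carrier F" "x = E a b" using E_cases[OF x] .
    obtain a' b' where ab': "a' \<in> carrier F" "b' \<in> carrier F" "y = E a' b'" using E_cases[OF y] .
    note cl = s_simps(1)[OF ab(1)] s_simps(1)[OF ab(2)] s_simps(1)[OF ab'(1)] s_simps(1)[OF ab'(2)]
    show "f (x \<oplus>\<^bsub>R\<^esub> y) = f x \<oplus>\<^bsub>R\<^esub> f y"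
      using ab ab' c cl by (simp add: E_add f s_simps r_distr)
    have "c \<otimes> (s a \<otimes> s b' \<oplus> s b \<otimes> s a') = s a \<otimes> (c \<otimes> s b') \<oplus> c \<otimes> s b \<otimes> s a'"
      using c(1) cl by algebra
    then show "f (x \<otimes>\<^bsub>R\<^esub> y) = f x \<otimes>\<^bsub>R\<^esub> f y"
      using ab ab' c cl by (simp add: E_mult f s_simps)
  qed (use c s_simps in \<open>auto simp: f elim!: E_cases\<close>)
  then show ?thesis using f that by blast
qed

text \<open>More than two elements provide a scalar \<open>c\<close> other than \<open>0\<close> and
  \<open>1\<close>. The automorphism that fixes the constants and scales \<open>\<epsilon>\<close>
  by \<open>c\<close> fixes \<open>a + b \<epsilon>\<close> only if \<open>b = 0\<close>.\<close>

lemma aut_fixed_ring_subset: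
  assumes "order F > 2" and x: "x \<in> aut_fixed_ring R"
  obtains a where "a \<in> carrier F" "x = E a \<zero>"
proof -
  have "\<not> carrier F \<subseteq> {\<zero>, \<one>}"
  proof
    assume "carrier F \<subseteq> {\<zero>, \<one>}"
    then have "card (carrier F) \<le> card {\<zero>, \<one>}" by (intro card_mono) auto
    then show False using assms(1) by (simp add: order_def)
  qed
  then obtain c where c: "c \<in> carrier F" "c \<noteq> \<zero>" "c \<noteq> \<one>" by auto
  have "(\<lambda>a. a) \<in> ring_iso F F" using ring_iso_set_refl by (simp add: id_def)
  from obtain_automorphism[OF this c(1,2)] obtain f where f: "f \<in> ring_iso R R"
    "\<And>a b. a \<in> carrier F \<Longrightarrow> b \<in> carrier F \<Longrightarrow> f (E a b) = E a (c \<otimes> b)"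
    by blast
  have xR: "x \<in> carrier R" and fx: "f x = x" using x f(1) by (auto simp: R.aut_fixed_ring_iff)
  obtain a b where ab: "a \<in> carrier F" "b \<in> carrier F" "x = E a b" using E_cases[OF xR] .
  have "c \<otimes> b = \<one> \<otimes> b" using fx ab c by (simp add: f E_inject)
  then have "b = \<zero>" using ab c m_rcancel[of b c \<one>] by auto
  then show ?thesis using that ab by blast
qed

lemma zero_in_extended_submonoid: "extended_submonoid R N \<Longrightarrow> \<zero>\<^bsub>R\<^esub> \<in> N"
proof -
  have "\<zero>\<^bsub>R\<^esub> \<in> aut_fixed_ring R"
    using ring_hom_zero[OF _ R.ring_axioms R.ring_axioms] by (auto simp: R.aut_fixed_ring_iff ring_iso_def)
  then show "extended_submonoid R N \<Longrightarrow> \<zero>\<^bsub>R\<^esub> \<in> N" by (auto simp: extended_submonoid_def)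
qed

end

section \<open>Covering for n at most 3\<close>

lemma submonoid_pow_closed:
  assumes "submonoid N G" "x \<in> N"
  shows "x [^]\<^bsub>G\<^esub> (k :: nat) \<in> N"
  by (induction k) (use assms submonoid.one_closed submonoid.m_closed in \<open>auto simp: nat_pow_def\<close>)

context dual_numbers
begin

text \<open>Automorphisms of \<open>R/(\<epsilon>)\<close> are transported to \<open>F\<close> along
  \<open>proj\<close>. Lifting every field automorphism \<open>s\<close> includes those whose
  transport stabilizes the image of \<open>N\<close>.\<close>

lemma covering_eps_idealI:
  assumes N: "extended_submonoid R N" and sub: "N \<subseteq> M" "M - N \<subseteq> eps_ideal"
    and lift: "\<And>s. s \<in> ring_iso F F \<Longrightarrow> \<exists>f \<in> ring_iso R R. f ` N = N \<and>
      (\<forall>a \<in> carrier F. \<forall>b \<in> carrier F. E a b \<in> N \<longrightarrow> eps_ideal +>\<^bsub>R\<^esub> f (E a b) = proj (s a))"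
  shows "covering_ideal R (aut_groups R) aut_actions M eps_ideal"
  unfolding covering_ideal_def
proof (intro conjI exI[of _ N] ballI)
  have NR: "N \<subseteq> carrier R" using N submonoid.subset by (auto simp: extended_submonoid_def)
  fix g assume "g \<in> setwise_stabilizer (aut_groups R eps_ideal) (aut_actions eps_ideal)
    ((+>\<^bsub>R\<^esub>) eps_ideal ` N)"
  then have "g \<in> ring_auto (R Quot eps_ideal)"
    by (auto simp: setwise_stabilizer_def aut_groups_def RingAutoGroup_def)
  then obtain s where s: "s \<in> ring_iso F F" "\<And>a. a \<in> carrier F \<Longrightarrow> g (proj a) = proj (s a)"
    using ring_auto_pullback[OF proj_iso] by blast
  obtain f where f: "f \<in> ring_iso R R" "f ` N = N"
    and lf: "\<forall>a \<in> carrier F. \<forall>b \<in> carrier F. E a b \<in> N \<longrightarrow> eps_ideal +>\<^bsub>R\<^esub> f (E a b) = proj (s a)"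
    using lift[OF s(1)] by (elim bexE conjE)
  have "eps_ideal +>\<^bsub>R\<^esub> f x = aut_actions eps_ideal g (eps_ideal +>\<^bsub>R\<^esub> x)" if x: "x \<in> N" for x
  proof -
    obtain a b where ab: "a \<in> carrier F" "b \<in> carrier F" "x = E a b"
      using E_cases[OF subsetD[OF NR x]] .
    have "eps_ideal +>\<^bsub>R\<^esub> f x = proj (s a)" using lf x ab by blast
    then show ?thesis using ab s(2)[OF ab(1)] by (simp add: aut_actions_def coset_E)
  qed
  then have "\<exists>f \<in> ring_iso R R. f ` N = N \<and>
      (\<forall>x \<in> N. eps_ideal +>\<^bsub>R\<^esub> f x = aut_actions eps_ideal g (eps_ideal +>\<^bsub>R\<^esub> x))"
    using f by (intro bexI[of _ f] conjI ballI)
  then show "\<exists>h \<in> setwise_stabilizer (aut_groups R {\<zero>\<^bsub>R\<^esub>}) (top_action R aut_actions) N.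
      \<forall>x \<in> N. eps_ideal +>\<^bsub>R\<^esub> top_action R aut_actions h x
        = aut_actions eps_ideal g (eps_ideal +>\<^bsub>R\<^esub> x)"
    by (rule iffD2[OF R.ex_top_stabilizer_iff[OF NR, of "\<lambda>x y. eps_ideal +>\<^bsub>R\<^esub> y
        = aut_actions eps_ideal g (eps_ideal +>\<^bsub>R\<^esub> x)"]])
qed (use N sub ideal_eps_ideal in simp_all)

text \<open>The two-element field has only the identity automorphism, which lifts to the identity of
  \<open>R\<close>; \<open>M\<close> itself serves as the smaller submonoid.\<close>

lemma covering_eps_ideal_order_2:
  assumes "order F = 2" and M: "extended_submonoid R M"
  shows "covering_ideal R (aut_groups R) aut_actions M eps_ideal"
proof (rule covering_eps_idealI[OF M])
  fix s assume s: "s \<in> ring_iso F F"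
  have "card (carrier F) = card {\<zero>, \<one>}" using assms(1) by (simp add: order_def)
  then have car: "carrier F = {\<zero>, \<one>}"
    using card_subset_eq[OF finite_carrier, of "{\<zero>, \<one>}"] by simp
  have "s \<zero> = \<zero>" using ring_hom_zero[OF _ ring_axioms ring_axioms] s by (simp add: ring_iso_def)
  moreover have "s \<one> = \<one>" using ring_iso_memE(4)[OF s] .
  ultimately have "s a = a" if "a \<in> carrier F" for a using that car by auto
  then show "\<exists>f \<in> ring_iso R R. f ` M = M \<and>
      (\<forall>a \<in> carrier F. \<forall>b \<in> carrier F. E a b \<in> M \<longrightarrow> eps_ideal +>\<^bsub>R\<^esub> f (E a b) = proj (s a))"
    using ring_iso_set_refl[of R] by (intro bexI[of _ id]) (auto simp: coset_E)
qed auto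

text \<open>Elements of \<open>M\<close> with nonzero constant term factor inside \<open>M\<close>
  as \<open>a (1 + v \<epsilon>)\<close>. A field automorphism preserves the set of possible
  \<open>a\<close>, and a suitable scaling of \<open>\<epsilon>\<close> brings the image of the set
  of possible \<open>v\<close> back to that set.\<close>

lemma covering_eps_ideal_le_3:
  assumes q: "order F > 2" and n: "n \<le> 3" and M: "extended_submonoid R M"
  shows "covering_ideal R (aut_groups R) aut_actions M eps_ideal"
proof -
  \<comment> \<open>The nonzero multiples of \<open>\<epsilon>\<close> are discarded, as
    \<open>(\<epsilon>)\<close> allows; zero stays because every automorphism fixes it.\<close>
  define N where "N = insert \<zero>\<^bsub>R\<^esub> (M - eps_ideal)"
  have sM: "submonoid M R" and fM: "aut_fixed_ring R \<subseteq> M" using M by (auto simp: extended_submonoid_def)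
  have MR: "M \<subseteq> carrier R" by (rule submonoid.subset[OF sM])
  have 0: "\<zero>\<^bsub>R\<^esub> \<in> M" by (rule zero_in_extended_submonoid[OF M])
  have NM: "N \<subseteq> M" using 0 by (auto simp: N_def)
  have memN: "E a b \<in> N \<longleftrightarrow> E a b \<in> M \<and> (a = \<zero> \<longrightarrow> b = \<zero>)"
    if "a \<in> carrier F" "b \<in> carrier F" for a b
    using that 0 by (auto simp: N_def E_in_eps_ideal E_zero E_inject)
  have N: "extended_submonoid R N"
    unfolding extended_submonoid_def
  proof (intro conjI submonoid.intro)
    show "N \<subseteq> carrier R" using NM MR by blast
    show "\<one>\<^bsub>R\<^esub> \<in> N" using submonoid.one_closed[OF sM] by (simp add: E_one memN)
    show "aut_fixed_ring R \<subseteq> N"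
    proof
      fix x assume x: "x \<in> aut_fixed_ring R"
      obtain a where "a \<in> carrier F" "x = E a \<zero>" using aut_fixed_ring_subset[OF q x] .
      then show "x \<in> N" using x fM by (auto simp: memN)
    qed
    fix x y assume x: "x \<in> N" and y: "y \<in> N"
    obtain a b where ab: "a \<in> carrier F" "b \<in> carrier F" "x = E a b"
      using E_cases[OF subsetD[OF MR subsetD[OF NM x]]] .
    obtain c d where cd: "c \<in> carrier F" "d \<in> carrier F" "y = E c d"
      using E_cases[OF subsetD[OF MR subsetD[OF NM y]]] .
    have "x \<otimes>\<^bsub>R\<^esub> y \<in> M" using x y NM by (intro submonoid.m_closed[OF sM]) auto
    \<comment> \<open>If the product has constant term zero, so has one of the factors, and in
      \<open>N\<close> that factor is zero.\<close>
    moreover have "a \<otimes> d \<oplus> b \<otimes> c = \<zero>" if "a \<otimes> c = \<zero>"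
      using that ab cd x y by (auto simp: memN integral_iff)
    ultimately show "x \<otimes>\<^bsub>R\<^esub> y \<in> N" using ab cd by (simp add: E_mult memN)
  qed
  define V where "V = {v \<in> carrier F. E \<one> v \<in> M}"
  have V: "additive_subgroup V F"
  proof (intro additive_subgroupI subgroup.intro)
    fix v assume v: "v \<in> V"
    show "inv\<^bsub>add_monoid F\<^esub> v \<in> V"
    proof -
      have vc: "v \<in> carrier F" "E \<one> v \<in> M" using v by (auto simp: V_def)
      \<comment> \<open>\<open>M\<close> is only known to be a monoid, so the inverse of
        \<open>1 + v \<epsilon>\<close> is obtained as its power with exponent
        \<open>order F - 1\<close>.\<close>
      have "add_pow F (order F - 1) v \<oplus> v = add_pow F (Suc (order F - 1)) v" using vc by simp
      also have "\<dots> = \<zero>" using add_pow_order[OF vc(1)] order_gt_1 by simp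
      finally have "\<ominus> v = add_pow F (order F - 1) v" using vc by (intro minus_equality) auto
      moreover have "E \<one> (add_pow F (order F - 1) v) \<in> M"
        using submonoid_pow_closed[OF sM vc(2), of "order F - 1"] vc by (simp add: E_power_unipotent)
      ultimately show ?thesis using vc by (simp add: V_def flip: a_inv_def)
    qed
    fix w assume w: "w \<in> V"
    have "E \<one> v \<otimes>\<^bsub>R\<^esub> E \<one> w \<in> M" using v w by (intro submonoid.m_closed[OF sM]) (auto simp: V_def)
    then show "v \<otimes>\<^bsub>add_monoid F\<^esub> w \<in> V" using v w by (auto simp: V_def E_mult a_comm)
  qed (use submonoid.one_closed[OF sM] in \<open>auto simp: V_def E_one\<close>)
  have split: "E a \<zero> \<in> M" "inv a \<otimes> b \<in> V"
    if ab: "a \<in> carrier F" "b \<in> carrier F" "E a b \<in> M" "a \<noteq> \<zero>" for a b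
  proof -
    have ai: "inv a \<in> carrier F" "inv a \<otimes> a = \<one>" "a \<otimes> inv a = \<one>" using ab field_Units by auto
    have dec: "E a b = E a \<zero> \<otimes>\<^bsub>R\<^esub> E \<one> (inv a \<otimes> b)"
      using ab ai by (simp add: E_mult flip: m_assoc)
    \<comment> \<open>The exponent \<open>q = order F\<close> separates the factors:
      \<open>a^q = a\<close>, while
      \<open>(1 + v \<epsilon>)^q = 1 + q v \<epsilon> = 1\<close>.\<close>
    have "E a b [^]\<^bsub>R\<^esub> order F = E a \<zero> [^]\<^bsub>R\<^esub> order F \<otimes>\<^bsub>R\<^esub> E \<one> (inv a \<otimes> b) [^]\<^bsub>R\<^esub> order F"
      unfolding dec using ab ai by (intro R.nat_pow_distrib) auto
    also have "\<dots> = E a \<zero>"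
      using ab ai by (simp add: E_power_fst E_power_unipotent power_order add_pow_order E_mult)
    finally show a: "E a \<zero> \<in> M" using submonoid_pow_closed[OF sM ab(3), of "order F"] by simp
    \<comment> \<open>Again the inverse is a power, \<open>a^(q-2)\<close>, and so stays in
      \<open>M\<close>.\<close>
    have "a [^] (order F - 2) \<otimes> a = \<one>"
      using power_order_minus_1[of a] ab order_gt_1 q nat_pow_Suc[of a "order F - 2"]
      by (simp add: Suc_diff_Suc numeral_2_eq_2)
    then have "a [^] (order F - 2) = inv a" using ab ai
      by (metis comm_inv_char m_comm nat_pow_closed)
    then have "E (inv a) \<zero> \<in> M"
      using submonoid_pow_closed[OF sM a, of "order F - 2"] ab by (simp add: E_power_fst)
    then have "E (inv a) \<zero> \<otimes>\<^bsub>R\<^esub> E a b \<in> M" using ab by (intro submonoid.m_closed[OF sM])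
    then show "inv a \<otimes> b \<in> V" using ab ai by (simp add: E_mult V_def)
  qed
  show ?thesis
  proof (rule covering_eps_idealI[OF N NM])
    show "M - N \<subseteq> eps_ideal" by (auto simp: N_def)
    fix s assume s: "s \<in> ring_iso F F"
    interpret s: ring_hom_ring F F s
      using s ring_axioms by (auto simp: ring_iso_def intro!: ring_hom_ringI2)
    obtain m :: nat where m: "\<And>a. a \<in> carrier F \<Longrightarrow> a \<noteq> \<zero> \<Longrightarrow> s a = a [^] m"
      using ring_iso_power[OF s] by blast
    have inj: "inj_on s (carrier F)" using bij_betw_imp_inj_on[OF ring_iso_memE(5)[OF s]] .
    have "additive_subgroup (s ` V) F"
    proof (intro additive_subgroupI subgroup.intro)
      interpret V: additive_subgroup V F by (rule V)
      note Vc = V.a_subset[THEN subsetD]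
      show "s ` V \<subseteq> carrier (add_monoid F)" using Vc by auto
      show "\<one>\<^bsub>add_monoid F\<^esub> \<in> s ` V" using V.zero_closed by (auto intro!: image_eqI[of _ _ \<zero>])
      show "inv\<^bsub>add_monoid F\<^esub> x \<in> s ` V" if "x \<in> s ` V" for x
        using that Vc by (auto simp flip: a_inv_def s.hom_a_inv)
      show "x \<otimes>\<^bsub>add_monoid F\<^esub> y \<in> s ` V" if "x \<in> s ` V" "y \<in> s ` V" for x y
        using that Vc by (auto simp flip: s.hom_add)
    qed
    moreover have "card (s ` V) = card V"
      using inj by (intro card_image inj_on_subset[OF inj]) (auto simp: V_def)
    \<comment> \<open>The image of \<open>V\<close> under \<open>s\<close> has the same order as
      \<open>V\<close>, so for \<open>n \<le> 3\<close> a scalar carries it back into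
      \<open>V\<close>.\<close>
    ultimately obtain c where c: "c \<in> carrier F" "c \<noteq> \<zero>" "\<And>v. v \<in> s ` V \<Longrightarrow> c \<otimes> v \<in> V"
      using additive_subgroup_scaling[OF _ V _ n] by blast
    obtain f where f: "f \<in> ring_iso R R"
      "\<And>a b. a \<in> carrier F \<Longrightarrow> b \<in> carrier F \<Longrightarrow> f (E a b) = E (s a) (c \<otimes> s b)"
      using obtain_automorphism[OF s c(1,2)] by blast
    have "f x \<in> N" if x: "x \<in> N" for x
    proof -
      obtain a b where ab: "a \<in> carrier F" "b \<in> carrier F" "x = E a b"
      using E_cases[OF subsetD[OF MR subsetD[OF NM x]]] .
      show ?thesis
      proof (cases "a = \<zero>")
        case True
        then have "x = E \<zero> \<zero>" using x ab by (simp add: memN)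
        then have "f x = E \<zero> \<zero>" using c by (simp add: f)
        then show ?thesis by (simp add: N_def E_zero)
      next
        case False
        have x': "E a b \<in> M" using x ab NM by blast
        note sp = split[OF ab(1,2) x' False]
        have sa: "s a \<noteq> \<zero>" using inj_onD[OF inj, of a \<zero>] False ab by auto
        have ai: "inv a \<in> carrier F" "a \<otimes> inv a = \<one>" using ab False field_Units by auto
        \<comment> \<open>\<open>s a\<close> is the power \<open>a [^] m\<close>, and
          \<open>M\<close> is closed under powers.\<close>
        have "E (s a) \<zero> \<in> M"
          using submonoid_pow_closed[OF sM sp(1), of m] m[OF ab(1) False] ab by (simp add: E_power_fst)
        moreover have "E \<one> (c \<otimes> s (inv a \<otimes> b)) \<in> M" using c(3)[of "s (inv a \<otimes> b)"] sp(2) by (auto simp: V_def)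
        ultimately have "E (s a) \<zero> \<otimes>\<^bsub>R\<^esub> E \<one> (c \<otimes> s (inv a \<otimes> b)) \<in> M" by (rule submonoid.m_closed[OF sM])
        moreover have "s a \<otimes> (c \<otimes> s (inv a \<otimes> b)) = c \<otimes> s b"
        proof -
          have "s a \<otimes> (c \<otimes> s (inv a \<otimes> b)) = c \<otimes> (s a \<otimes> s (inv a \<otimes> b))"
            using c ab ai by (intro m_lcomm) auto
          also have "s a \<otimes> s (inv a \<otimes> b) = s (a \<otimes> (inv a \<otimes> b))" using ab ai by simp
          also have "a \<otimes> (inv a \<otimes> b) = b" using ab ai by (simp flip: m_assoc)
          finally show ?thesis .
        qed
        ultimately have "f x \<in> M" using ab ai c by (simp add: f E_mult)
        then show ?thesis using ab c sa by (simp add: f memN)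
      qed
    qed
    then have sub: "f ` N \<subseteq> N" by blast
    have "finite (carrier R)" using bij_betw_finite[OF E_bij] finite_carrier by simp
    then have fin: "finite N" using NM MR by (meson finite_subset)
    have "inj_on f N"
      using NM MR by (intro inj_on_subset[OF bij_betw_imp_inj_on[OF ring_iso_memE(5)[OF f(1)]]]) auto
    then have "f ` N = N" by (rule endo_inj_surj[OF fin sub])
    then show "\<exists>f \<in> ring_iso R R. f ` N = N \<and>
      (\<forall>a \<in> carrier F. \<forall>b \<in> carrier F. E a b \<in> N \<longrightarrow> eps_ideal +>\<^bsub>R\<^esub> f (E a b) = proj (s a))"
      using f c by (intro bexI[of _ f]) (auto simp: coset_E)
  qed
qed

lemma monoidal_network_le_3:
  assumes "n \<le> 3"
  shows "monoidal_network R (aut_groups R) aut_actions"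
  unfolding monoidal_network_def
proof (intro conjI allI impI)
  show "multiaction R (aut_groups R) aut_actions" by (rule multiaction_aut[OF R.cring_axioms])
  fix M assume M: "extended_submonoid R M"
  have "covering_ideal R (aut_groups R) aut_actions M eps_ideal"
    using covering_eps_ideal_order_2[OF _ M] covering_eps_ideal_le_3[OF _ assms M] order_gt_1
    by (cases "order F = 2") auto
  then show "\<exists>I. covering_ideal R (aut_groups R) aut_actions M I \<and> I \<noteq> carrier R \<and> I \<noteq> {\<zero>\<^bsub>R\<^esub>}"
    using eps_ideal_proper by blast
qed

section \<open>Failure for n at least 4\<close>

lemma not_monoidal_network_ge_4:
  assumes n: "n \<ge> 4"
  shows "\<not> monoidal_network R (aut_groups R) aut_actions"
proof
  assume net: "monoidal_network R (aut_groups R) aut_actions"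
  obtain t where t: "t \<in> carrier F" "moebius_free t" using ex_moebius_free[OF n] .
  define V where "V = {c \<otimes> t \<oplus> d | c d. c \<in> frobenius_fixed \<and> d \<in> frobenius_fixed}"
  \<comment> \<open>These are the products \<open>a (1 + v \<epsilon>)\<close> with \<open>a\<close>
    in \<open>F\<close> and \<open>v\<close> in the span \<open>V\<close> of \<open>1\<close> and
    \<open>t\<close> over the prime field.\<close>
  define M where "M = {E a (a \<otimes> v) | a v. a \<in> carrier F \<and> v \<in> V}"
  have V_I: "c \<otimes> t \<oplus> d \<in> V" if "c \<in> frobenius_fixed" "d \<in> frobenius_fixed" for c d
    using that by (auto simp: V_def)
  have Vc: "v \<in> carrier F" if "v \<in> V" for v using that t frobenius_fixed_carrier by (auto simp: V_def)
  have V: "\<zero> \<in> V" "\<one> \<in> V" "t \<in> V"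
    using V_I[of \<zero> \<zero>] V_I[of \<zero> \<one>] V_I[of \<one> \<zero>] t by simp_all
  have V_add: "v \<oplus> w \<in> V" if v: "v \<in> V" and w: "w \<in> V" for v w
  proof -
    obtain c d where cd: "c \<in> frobenius_fixed" "d \<in> frobenius_fixed" "v = c \<otimes> t \<oplus> d"
      using v by (auto simp: V_def)
    obtain c' d' where cd': "c' \<in> frobenius_fixed" "d' \<in> frobenius_fixed" "w = c' \<otimes> t \<oplus> d'"
      using w by (auto simp: V_def)
    have "v \<oplus> w = (c \<oplus> c') \<otimes> t \<oplus> (d \<oplus> d')"
      unfolding cd(3) cd'(3) using t(1) cd(1,2)[THEN frobenius_fixed_carrier] cd'(1,2)[THEN frobenius_fixed_carrier]
      by algebra
    then show ?thesis using V_I[of "c \<oplus> c'" "d \<oplus> d'"] cd cd' by simp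
  qed
  have M_I: "E a (a \<otimes> v) \<in> M" if "a \<in> carrier F" "v \<in> V" for a v using that by (auto simp: M_def)
  have E0_M: "E a \<zero> \<in> M" if "a \<in> carrier F" for a using M_I[OF that V(1)] that by simp
  have E1_M: "E \<one> v \<in> M \<longleftrightarrow> v \<in> V" if "v \<in> carrier F" for v
  proof
    assume "E \<one> v \<in> M"
    then obtain a w where "a \<in> carrier F" "w \<in> V" "E \<one> v = E a (a \<otimes> w)" by (auto simp: M_def)
    then show "v \<in> V" using that Vc by (auto simp: E_inject)
  next
    assume "v \<in> V"
    then show "E \<one> v \<in> M" using M_I[of \<one> v] Vc by simp
  qed
  have MR: "M \<subseteq> carrier R" using Vc by (auto simp: M_def)
  have "p ^ 2 \<le> p ^ n" using n prime_ge_1_nat[OF prime_p] by (intro power_increasing) auto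
  moreover have "2 ^ 2 \<le> p ^ 2" using prime_ge_2_nat[OF prime_p] by (intro power_mono) auto
  ultimately have q: "order F > 2" unfolding order_F by simp
  have M: "extended_submonoid R M"
    unfolding extended_submonoid_def
  proof (intro conjI submonoid.intro)
    show "\<one>\<^bsub>R\<^esub> \<in> M" using E0_M[of \<one>] by (simp add: E_one)
    show "aut_fixed_ring R \<subseteq> M"
    proof
      fix x assume "x \<in> aut_fixed_ring R"
      then show "x \<in> M" using aut_fixed_ring_subset[OF q] E0_M by metis
    qed
    fix x y assume "x \<in> M" "y \<in> M"
    then obtain a v b w where *: "a \<in> carrier F" "v \<in> V" "x = E a (a \<otimes> v)"
      "b \<in> carrier F" "w \<in> V" "y = E b (b \<otimes> w)"
      by (auto simp: M_def)
    have "a \<otimes> (b \<otimes> w) \<oplus> a \<otimes> v \<otimes> b = (a \<otimes> b) \<otimes> (v \<oplus> w)"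
      using *(1,4) Vc[OF *(2)] Vc[OF *(5)] by algebra
    then show "x \<otimes>\<^bsub>R\<^esub> y \<in> M" using * Vc M_I[of "a \<otimes> b" "v \<oplus> w"] V_add by (simp add: E_mult)
  qed (rule MR)
  obtain I where cov: "covering_ideal R (aut_groups R) aut_actions M I" and I: "I \<noteq> carrier R" "I \<noteq> {\<zero>\<^bsub>R\<^esub>}"
    using net M unfolding monoidal_network_def by blast
  have "ideal I R" using cov by (simp add: covering_ideal_def)
  then have "I = eps_ideal" using I by (rule proper_nonzero_ideal)
  with cov obtain N where N: "extended_submonoid R N" "N \<subseteq> M" "M - N \<subseteq> eps_ideal"
    and lift: "\<forall>g \<in> setwise_stabilizer (aut_groups R eps_ideal) (aut_actions eps_ideal) ((+>\<^bsub>R\<^esub>) eps_ideal ` N).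
          \<exists>h \<in> setwise_stabilizer (aut_groups R {\<zero>\<^bsub>R\<^esub>}) (top_action R aut_actions) N.
            \<forall>x \<in> N. eps_ideal +>\<^bsub>R\<^esub> top_action R aut_actions h x = aut_actions eps_ideal g (eps_ideal +>\<^bsub>R\<^esub> x)"
    unfolding covering_ideal_def by blast
  have "M \<subseteq> N"
  proof (rule ccontr)
    assume "\<not> M \<subseteq> N"
    then obtain x where x: "x \<in> M" "x \<notin> N" by blast
    then obtain a v where av: "a \<in> carrier F" "v \<in> V" "x = E a (a \<otimes> v)" by (auto simp: M_def)
    have "E a (a \<otimes> v) \<in> eps_ideal" using x av N(3) by blast
    then have "a = \<zero>" using av Vc by (simp add: E_in_eps_ideal)
    then have "x = \<zero>\<^bsub>R\<^esub>" using av Vc by (simp add: E_zero)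
    then show False using x zero_in_extended_submonoid[OF N(1)] by simp
  qed
  then have NM: "N = M" using N(2) by blast
  have cosets: "(+>\<^bsub>R\<^esub>) eps_ideal ` M = proj ` carrier F"
  proof
    show "(+>\<^bsub>R\<^esub>) eps_ideal ` M \<subseteq> proj ` carrier F" using Vc by (auto simp: M_def coset_E)
    show "proj ` carrier F \<subseteq> (+>\<^bsub>R\<^esub>) eps_ideal ` M" using E0_M by (auto simp: proj_def)
  qed
  \<comment> \<open>Frobenius is an admissible \<open>g\<close>: the image of \<open>M\<close> is
    all of \<open>R/(\<epsilon>)\<close>, so every automorphism stabilizes it.\<close>
  obtain g where g: "g \<in> ring_auto (R Quot eps_ideal)"
    and gp: "\<And>a. a \<in> carrier F \<Longrightarrow> g (proj a) = proj (a [^] p)"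
    using ring_auto_pushforward[OF ideal.quotient_is_ring[OF ideal_eps_ideal] proj_iso frobenius_iso] by blast
  have "g ` proj ` carrier F = proj ` (\<lambda>x. x [^] p) ` carrier F"
    unfolding image_image by (rule image_cong) (simp_all add: gp)
  also have "(\<lambda>x. x [^] p) ` carrier F = carrier F"
    using ring_iso_memE(5)[OF frobenius_iso] by (rule bij_betw_imp_surj_on)
  finally have "g \<in> setwise_stabilizer (aut_groups R eps_ideal) (aut_actions eps_ideal) ((+>\<^bsub>R\<^esub>) eps_ideal ` M)"
    using g by (simp add: setwise_stabilizer_def aut_groups_def RingAutoGroup_def aut_actions_def[abs_def] cosets)
  then have ex_h: "\<exists>h \<in> setwise_stabilizer (aut_groups R {\<zero>\<^bsub>R\<^esub>}) (top_action R aut_actions) M.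
      \<forall>x \<in> M. eps_ideal +>\<^bsub>R\<^esub> top_action R aut_actions h x = aut_actions eps_ideal g (eps_ideal +>\<^bsub>R\<^esub> x)"
    using lift unfolding NM by (rule bspec[rotated])
  obtain f where f: "f \<in> ring_iso R R" "f ` M = M"
    and fg: "\<forall>x \<in> M. eps_ideal +>\<^bsub>R\<^esub> f x = aut_actions eps_ideal g (eps_ideal +>\<^bsub>R\<^esub> x)"
    using iffD1[OF R.ex_top_stabilizer_iff[OF MR, of "\<lambda>x y. eps_ideal +>\<^bsub>R\<^esub> y
        = aut_actions eps_ideal g (eps_ideal +>\<^bsub>R\<^esub> x)"] ex_h] by (elim bexE conjE)
  have f_E: "\<exists>y \<in> carrier F. f (E a b) = E (a [^] p) y"
    if ab: "a \<in> carrier F" "b \<in> carrier F" "E a b \<in> M" for a b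
  proof -
    have "f (E a b) \<in> carrier R" using ring_iso_memE(1)[OF f(1)] ab by simp
    then obtain a' y where y: "a' \<in> carrier F" "y \<in> carrier F" "f (E a b) = E a' y" by (rule E_cases)
    have "proj a' = eps_ideal +>\<^bsub>R\<^esub> f (E a b)" using y by (simp add: coset_E)
    also have "\<dots> = g (eps_ideal +>\<^bsub>R\<^esub> E a b)" using fg ab(3) by (simp add: aut_actions_def)
    also have "\<dots> = proj (a [^] p)" using ab by (simp add: coset_E gp)
    finally have "a' = a [^] p" using y ab by (simp add: proj_def coset_eq_iff)
    then show ?thesis using y by blast
  qed
  note f_hom = ring_iso_memE(2-4)[OF f(1)]
  have f1: "f (E \<one> \<zero>) = E \<one> \<zero>" using f_hom(3) by (simp add: E_one)
  obtain c where c: "c \<in> carrier F" "f (E \<one> \<one>) = E \<one> c"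
    using f_E[of \<one> \<one>] E1_M[of \<one>] V by auto
  \<comment> \<open>The lifting condition speaks of \<open>M\<close> only, and
    \<open>\<epsilon>\<close> lies outside \<open>M\<close>. Its image is found from those of
    \<open>1 + \<epsilon>\<close> and \<open>1\<close>.\<close>
  have f_eps: "f (E \<zero> \<one>) = E \<zero> c"
  proof -
    have fc: "f (E \<zero> \<one>) \<in> carrier R" using ring_iso_memE(1)[OF f(1)] by simp
    obtain a b where ab: "a \<in> carrier F" "b \<in> carrier F" "f (E \<zero> \<one>) = E a b" using E_cases[OF fc] .
    have "E \<one> c = f (E \<one> \<zero> \<oplus>\<^bsub>R\<^esub> E \<zero> \<one>)" by (simp add: E_add c)
    also have "\<dots> = E (\<one> \<oplus> a) b" using f_hom(2)[of "E \<one> \<zero>" "E \<zero> \<one>"] ab f1 by (simp add: E_add)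
    finally have "\<one> \<oplus> a = \<one>" "b = c" using ab c by (simp_all add: E_inject)
    then show ?thesis using ab add.r_cancel_one[of \<one> a] by simp
  qed
  have "c \<noteq> \<zero>"
  proof
    assume "c = \<zero>"
    moreover have "f \<zero>\<^bsub>R\<^esub> = \<zero>\<^bsub>R\<^esub>"
      by (rule ring_hom_zero[OF _ R.ring_axioms R.ring_axioms]) (use f(1) in \<open>simp add: ring_iso_def\<close>)
    ultimately have "f (E \<zero> \<one>) = f \<zero>\<^bsub>R\<^esub>" using f_eps E_zero by metis
    then have "E \<zero> \<one> = E \<zero> \<zero>"
      using inj_onD[OF bij_betw_imp_inj_on[OF ring_iso_memE(5)[OF f(1)]]] by (simp add: E_zero)
    then show False by (simp add: E_inject)
  qed
  have scaled: "c \<otimes> v [^] p \<in> V" if v: "v \<in> V" for v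
  proof -
    have vc: "v \<in> carrier F" by (rule Vc[OF v])
    obtain y where y: "y \<in> carrier F" "f (E v \<zero>) = E (v [^] p) y" using f_E[of v \<zero>] E0_M vc by auto
    \<comment> \<open>Writing \<open>v \<epsilon>\<close> as a product makes the unknown
      \<open>\<epsilon>\<close>-part \<open>y\<close> of the image of \<open>v\<close> disappear,
      since it is multiplied by \<open>\<epsilon>\<close>.\<close>
    have "f (E \<one> v) = f (E \<one> \<zero> \<oplus>\<^bsub>R\<^esub> E v \<zero> \<otimes>\<^bsub>R\<^esub> E \<zero> \<one>)" using vc by (simp add: E_add E_mult)
    also have "\<dots> = f (E \<one> \<zero>) \<oplus>\<^bsub>R\<^esub> f (E v \<zero>) \<otimes>\<^bsub>R\<^esub> f (E \<zero> \<one>)" using vc by (simp add: f_hom)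
    also have "\<dots> = E \<one> (c \<otimes> v [^] p)"
      unfolding f1 y f_eps using vc y c by (simp add: E_add E_mult m_comm)
    finally have "E \<one> (c \<otimes> v [^] p) = f (E \<one> v)" by (rule sym)
    also have "\<dots> \<in> f ` M" using E1_M[OF vc] v by simp
    also note f(2)
    finally have "E \<one> (c \<otimes> v [^] p) \<in> M" .
    then show ?thesis using E1_M vc c by simp
  qed
  \<comment> \<open>Taking \<open>v = 1\<close> and \<open>v = t\<close> puts both \<open>c\<close>
    and \<open>c t^p\<close> into \<open>V\<close>, which \<open>moebius_free\<close> forbids for
    nonzero \<open>c\<close>.\<close>
  have "c \<in> V" using scaled[OF V(2)] c by simp
  then obtain \<gamma> \<delta> where gd: "\<gamma> \<in> frobenius_fixed" "\<delta> \<in> frobenius_fixed" "c = \<gamma> \<otimes> t \<oplus> \<delta>"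
    by (auto simp: V_def)
  obtain a b where ab: "a \<in> frobenius_fixed" "b \<in> frobenius_fixed" "c \<otimes> t [^] p = a \<otimes> t \<oplus> b"
    using scaled[OF V(3)] by (auto simp: V_def)
  have "\<gamma> = \<zero> \<and> \<delta> = \<zero>" using t(2) ab gd unfolding moebius_free_def by blast
  then have "c = \<zero>" using gd t by simp
  with \<open>c \<noteq> \<zero>\<close> show False ..
qed

lemma monoidal_network_iff: "monoidal_network R (aut_groups R) aut_actions \<longleftrightarrow> n \<le> 3"
  using monoidal_network_le_3 not_monoidal_network_ge_4 by (cases "n \<le> 3") auto

end

section \<open>The ring F[X]/(X^2)\<close>

text \<open>Polynomials are coefficient lists with the highest degree first and no leading zeros,
  hence \<open>normalize\<close>.\<close>

lemma (in domain) linear_poly_eq_normalize: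
  assumes "subring K R" and "a \<in> K" "b \<in> K"
  shows "poly_of_const a \<oplus>\<^bsub>K[X]\<^esub> poly_of_const b \<otimes>\<^bsub>K[X]\<^esub> X = normalize [b, a]"
proof -
  have ab: "a \<in> carrier R" "b \<in> carrier R" using assms subringE(1) by auto
  have "poly_of_const b \<in> carrier (K[X])"
    using ring_hom_memE(1)[OF canonical_embedding_is_hom[OF assms(1)]] assms by simp
  then have "poly_of_const b \<otimes>\<^bsub>K[X]\<^esub> X = (if poly_of_const b = [] then [] else poly_of_const b @ [\<zero>])"
    by (rule poly_mult_var[OF assms(1)])
  then show ?thesis using ab by (simp add: univ_poly_add poly_of_const_def)
qed

text \<open>\<open>E a b\<close> is the class of \<open>a + b X\<close>. It is bijective because the
  pairs correspond to the remainders modulo \<open>X^2\<close>, which represent every residue class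
  exactly once.\<close>

lemma (in prime_power_field) dual_number_ring_dual_numbers:
  obtains E where "dual_numbers F p n (dual_number_ring F) E"
proof -
  let ?K = "carrier F" and ?P = "poly_ring F" and ?S = "dual_number_ring F"
  let ?X2 = "X [^]\<^bsub>?P\<^esub> (2::nat)"
  have sr: "subring ?K F" and sf: "subfield ?K F" by (rule carrier_is_subring, rule carrier_is_subfield)
  interpret P: domain ?P by (rule univ_poly_is_domain[OF sr])
  have Xc: "X \<in> carrier ?P" by (rule var_closed(1)[OF sr])
  then have X2c: "?X2 \<in> carrier ?P" by simp
  have X2: "?X2 = [\<one>, \<zero>, \<zero>]"
    using unitary_monom_eq_var_pow[OF sr, of 2] by (simp add: monom_def numeral_2_eq_2)
  have S: "?S = Rupt ?K ?X2" by (simp add: dual_number_ring_def)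
  have cring_S: "cring ?S"
    unfolding S rupture_def by (intro ideal.quotient_is_cring P.cgenideal_ideal X2c P.is_cring)
  then interpret S: cring ?S .
  define \<pi> where "\<pi> = rupture_surj ?K ?X2"
  have \<pi>: "\<pi> \<in> ring_hom ?P ?S" unfolding \<pi>_def S by (rule rupture_surj_hom(1)[OF sr X2c])
  have const: "poly_of_const \<in> ring_hom F ?P"
    using canonical_embedding_is_hom[OF sr] by simp
  define k where "k = \<pi> \<circ> poly_of_const"
  have k: "k \<in> ring_hom F ?S" unfolding k_def by (rule ring_hom_trans[OF const \<pi>])
  define e where "e = \<pi> X"
  have e: "e \<in> carrier ?S" unfolding e_def by (rule ring_hom_memE(1)[OF \<pi> Xc])
  have ee: "e \<otimes>\<^bsub>?S\<^esub> e = \<zero>\<^bsub>?S\<^esub>"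
  proof -
    have "e \<otimes>\<^bsub>?S\<^esub> e = \<pi> ?X2"
      using ring_hom_memE(2)[OF \<pi> Xc Xc] Xc by (simp add: e_def numeral_2_eq_2)
    also have "\<dots> = PIdl\<^bsub>?P\<^esub> ?X2"
      unfolding \<pi>_def by (rule P.a_rcos_zero[OF P.cgenideal_ideal[OF X2c] P.cgenideal_self[OF X2c]])
    also have "\<dots> = \<zero>\<^bsub>?S\<^esub>" by (simp add: S rupture_def FactRing_def)
    finally show ?thesis .
  qed
  define E where "E = (\<lambda>a b. k a \<oplus>\<^bsub>?S\<^esub> k b \<otimes>\<^bsub>?S\<^esub> e)"
  note k_hom = ring_hom_memE[OF k]
  define u where "u = (\<lambda>(a, b). poly_of_const a \<oplus>\<^bsub>?P\<^esub> poly_of_const b \<otimes>\<^bsub>?P\<^esub> X)"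
  have u: "u (a, b) = normalize [b, a]" if "a \<in> ?K" "b \<in> ?K" for a b
    using linear_poly_eq_normalize[OF sr that] by (simp only: u_def case_prod_conv)
  have u_closed: "u (a, b) \<in> carrier ?P" if "a \<in> ?K" "b \<in> ?K" for a b
    using that ring_hom_memE(1)[OF const] Xc by (simp add: u_def)
  have E_u: "E a b = \<pi> (u (a, b))" if "a \<in> ?K" "b \<in> ?K" for a b
    using that ring_hom_memE(1)[OF const] Xc
    by (simp add: E_def u_def k_def e_def ring_hom_memE(2,3)[OF \<pi>])
  have u_im: "u ` (?K \<times> ?K) = (\<lambda>q. pmod q ?X2) ` carrier ?P"
  proof -
    have "u ` (?K \<times> ?K) = {q \<in> carrier ?P. length q \<le> 2}"
    proof (intro equalityI subsetI)
      fix q assume "q \<in> u ` (?K \<times> ?K)"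
      then obtain a b where "a \<in> ?K" "b \<in> ?K" "q = u (a, b)" by auto
      then show "q \<in> {q \<in> carrier ?P. length q \<le> 2}" using u_closed u by auto
    next
      fix q assume "q \<in> {q \<in> carrier ?P. length q \<le> 2}"
      then have q: "polynomial ?K q" "length q \<le> 2" by (simp_all add: univ_poly_carrier)
      \<comment> \<open>The case rule merely splits lists into empty, singleton and longer ones; the
        length bound leaves two coefficients in the last case.\<close>
      then consider "q = []" | a where "q = [a]" | a b where "q = [b, a]"
        by (cases q rule: remdups_adj.cases) auto
      then show "q \<in> u ` (?K \<times> ?K)"
      proof cases
        case 1
        then show ?thesis by (intro image_eqI[of _ _ "(\<zero>, \<zero>)"]) (simp_all add: u)
      next
        case 2
        then have "a \<in> ?K" "a \<noteq> \<zero>" using q by (auto simp: polynomial_def)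
        then show ?thesis using 2 by (intro image_eqI[of _ _ "(a, \<zero>)"]) (simp_all add: u)
      next
        case 3
        then have "a \<in> ?K" "b \<in> ?K" "b \<noteq> \<zero>" using q by (auto simp: polynomial_def)
        then show ?thesis using 3 by (intro image_eqI[of _ _ "(a, b)"]) (simp_all add: u)
      qed
    qed
    then show ?thesis
      using pmod_image_characterization[OF sf X2c] unfolding X2 by (simp add: numeral_2_eq_2)
  qed
  have u_inj: "inj_on u (?K \<times> ?K)"
    by (rule inj_onI) (auto simp: u split: if_splits)
  have "bij_betw (\<lambda>x. \<pi> (u x)) (?K \<times> ?K) (carrier ?S)"
  proof (rule bij_betw_trans[of u _ "(\<lambda>q. pmod q ?X2) ` carrier ?P" \<pi>, unfolded comp_def])
    show "bij_betw u (?K \<times> ?K) ((\<lambda>q. pmod q ?X2) ` carrier ?P)"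
      using u_inj u_im by (simp add: bij_betw_def)
    show "bij_betw \<pi> ((\<lambda>q. pmod q ?X2) ` carrier ?P) (carrier ?S)"
      using rupture_surj_inj_on[OF sf X2c] rupture_carrier_as_pmod_image[OF sf X2c]
      by (simp add: bij_betw_def \<pi>_def S)
  qed
  moreover have "(\<pi> (u x) = (\<lambda>(a, b). E a b) x)" if "x \<in> ?K \<times> ?K" for x
    using that by (auto simp: E_u)
  ultimately have bij: "bij_betw (\<lambda>(a, b). E a b) (?K \<times> ?K) (carrier ?S)"
    by (subst (asm) bij_betw_cong) auto
  have "dual_numbers F p n ?S E"
  proof (intro dual_numbers.intro dual_numbers_axioms.intro)
    show "bij_betw (\<lambda>(a, b). E a b) (carrier F \<times> carrier F) (carrier ?S)" by (rule bij)
    show "\<one>\<^bsub>?S\<^esub> = E \<one> \<zero>"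
    proof -
      have "k \<zero> = \<zero>\<^bsub>?S\<^esub>" by (rule ring_hom_zero[OF k ring_axioms S.ring_axioms])
      then show ?thesis using e k_hom(4) by (simp add: E_def)
    qed
    fix a b c d assume abcd: "a \<in> ?K" "b \<in> ?K" "c \<in> ?K" "d \<in> ?K"
    note kc = abcd[THEN k_hom(1)]
    show "E a b \<oplus>\<^bsub>?S\<^esub> E c d = E (a \<oplus> c) (b \<oplus> d)"
      unfolding E_def using abcd kc e by (simp add: k_hom(3) S.l_distr S.a_ac)
    have "E a b \<otimes>\<^bsub>?S\<^esub> E c d = k a \<otimes>\<^bsub>?S\<^esub> k c \<oplus>\<^bsub>?S\<^esub> (k a \<otimes>\<^bsub>?S\<^esub> k d \<oplus>\<^bsub>?S\<^esub> k b \<otimes>\<^bsub>?S\<^esub> k c) \<otimes>\<^bsub>?S\<^esub> e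
      \<oplus>\<^bsub>?S\<^esub> k b \<otimes>\<^bsub>?S\<^esub> k d \<otimes>\<^bsub>?S\<^esub> (e \<otimes>\<^bsub>?S\<^esub> e)"
      unfolding E_def using kc e by algebra
    also have "\<dots> = E (a \<otimes> c) (a \<otimes> d \<oplus> b \<otimes> c)"
      unfolding ee E_def using abcd kc e by (simp add: k_hom(2,3))
    finally show "E a b \<otimes>\<^bsub>?S\<^esub> E c d = E (a \<otimes> c) (a \<otimes> d \<oplus> b \<otimes> c)" .
  qed (rule prime_power_field_axioms, rule cring_S)
  then show ?thesis by (rule that)
qed

theorem theorem2:
  fixes p n :: nat and F :: "('a, 'b) ring_scheme"
  assumes "Factorial_Ring.prime p" and "n \<ge> 1" and "field F" and "order F = p ^ n"
  shows "monoidal_network (dual_number_ring F) (aut_groups (dual_number_ring F)) aut_actions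
    \<longleftrightarrow> n \<le> 3"
proof -
  interpret prime_power_field F p n
    using assms by (intro prime_power_field.intro prime_power_field_axioms.intro)
  obtain E where "dual_numbers F p n (dual_number_ring F) E"
    by (rule dual_number_ring_dual_numbers)
  then show ?thesis by (rule dual_numbers.monoidal_network_iff)
qed

end
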